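(* Let $k\geq2$ be an integer and $\ell\in\{3,5\}$. Then, as $n\to\infty$, \[\mathrm{ex}(n,\mathcal{S}^kC_{2\ell})=\Theta(n^{k-1+1/\ell}),\] where the implied constants may depend on $k$ and $\ell$ but not on $n$.
   Context: For an integer $k\geq2$ and a graph $F$, the $k$-uniform suspension $\mathcal{S}^kF$ is the $k$-uniform hypergraph with vertex set $S\cup V(F)$ and edge set $\{S\cup e:\,e\in E(F)\}$, where $S$ is a set of size $k-2$ disjoint from $V(F)$. $C_{2\ell}$ is the cycle of length $2\ell$. A $k$-uniform hypergraph is $H$-free if it contains no (not necessarily induced) subhypergraph isomorphic to $H$. For a $k$-uniform hypergraph $H$, $\mathrm{ex}(n,H)$ is the maximum number of edges in an $n$-vertex $H$-free $k$-uniform hypergraph. *)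

theory Defs
  imports Complex_Main "HOL-Library.Landau_Symbols"
begin

text \<open>A hypergraph is a pair of a finite vertex set and a set of edges, each a subset of
  the vertex set; a graph is a 2-uniform hypergraph.\<close>

type_synonym 'a hypergraph = "'a set \<times> 'a set set"

abbreviation verts :: "'a hypergraph \<Rightarrow> 'a set" where "verts \<equiv> fst"
abbreviation edges :: "'a hypergraph \<Rightarrow> 'a set set" where "edges \<equiv> snd"

definition hypergraph :: "'a hypergraph \<Rightarrow> bool" where
  "hypergraph G \<longleftrightarrow> finite (verts G) \<and> (\<forall>e\<in>edges G. e \<subseteq> verts G)"

definition uniform_hypergraph :: "nat \<Rightarrow> 'a hypergraph \<Rightarrow> bool" where
  "uniform_hypergraph k G \<longleftrightarrow> hypergraph G \<and> (\<forall>e\<in>edges G. card e = k)"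

definition subhypergraph :: "'a hypergraph \<Rightarrow> 'a hypergraph \<Rightarrow> bool" where
  "subhypergraph H G \<longleftrightarrow> hypergraph H \<and> verts H \<subseteq> verts G \<and> edges H \<subseteq> edges G"

definition isomorphic :: "'a hypergraph \<Rightarrow> 'b hypergraph \<Rightarrow> bool" where
  "isomorphic G H \<longleftrightarrow> (\<exists>f. bij_betw f (verts G) (verts H) \<and> edges H = (\<lambda>e. f ` e) ` edges G)"

definition is_free :: "'a hypergraph \<Rightarrow> 'b hypergraph \<Rightarrow> bool" where
  "is_free H G \<longleftrightarrow> \<not> (\<exists>G'. subhypergraph G' G \<and> isomorphic H G')"

text \<open>The uniformity \<open>k\<close> of the forbidden hypergraph is passed explicitly. Every finite
  hypergraph has an isomorphic copy on natural numbers, so it suffices to let the host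
  hypergraphs range over those. The set below is bounded by \<open>n choose k\<close>, and it
  contains 0 whenever \<open>H\<close> has an edge, so \<open>Max\<close> is a genuine maximum.\<close>

definition ex_num :: "nat \<Rightarrow> nat \<Rightarrow> 'a hypergraph \<Rightarrow> nat" where
  "ex_num k n H = Max {card (edges G) | G :: nat hypergraph.
     uniform_hypergraph k G \<and> card (verts G) = n \<and> is_free H G}"

definition cycle :: "nat \<Rightarrow> nat hypergraph" where
  "cycle m = ({..<m}, {{i, Suc i mod m} | i. i < m})"

text \<open>The sum type makes the \<open>k - 2\<close> new vertices disjoint from those of \<open>F\<close>.\<close>

definition suspension :: "nat \<Rightarrow> 'a hypergraph \<Rightarrow> ('a + nat) hypergraph" where
  "suspension k F = (let S = Inr ` {..<k - 2} in
     (S \<union> Inl ` verts F, {S \<union> Inl ` e | e. e \<in> edges F}))"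

end

theory Submission
  imports Defs "HOL-Algebra.Algebraic_Closure_Type" "HOL-Library.Z2" "HOL-Library.FuncSet"
begin

text \<open>For the upper bound, the link of any \<open>k - 2\<close> vertices is a graph without a cycle of
  length \<open>2l\<close>, and the argument of Bondy and Simonovits applies to it: if two consecutive levels of
  a breadth-first search span too many edges, they contain a long cycle with a chord, this contains
  paths of all even lengths between suitable vertices of the upper level, and such a path closes up
  through the search tree to a cycle of length \<open>2l\<close>. So the levels grow geometrically.

  For the lower bound, let \<open>\<Gamma>\<close> be a finite group and \<open>A \<subseteq> \<Gamma>\<close>, take \<open>k\<close> disjoint copies of \<open>\<Gamma>\<close> as
  vertices, and let \<open>(g\<^sub>1, \<dots>, g\<^sub>k)\<close> be an edge if \<open>g\<^sub>1 + \<dots> + g\<^sub>k \<in> A\<close> (the group is written additively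
  but is not commutative). Fixing all but two of the summands, a cycle of length \<open>2l\<close> in a link
  telescopes to a relation \<open>\<Sum> (- x\<^sub>a + y\<^sub>a) = 0\<close> with \<open>x\<^sub>a, y\<^sub>a \<in> A\<close> and cyclically consecutive terms
  distinct. It thus suffices to find \<open>\<Gamma>\<close> of order \<open>q ^ l\<close> and \<open>A\<close> of size \<open>q\<close> without such relations.
  Let \<open>\<Gamma>\<close> consist of the linear functionals on polynomials of degree less than \<open>l\<close> over a field with
  \<open>q\<close> elements, with addition twisted by translations, and \<open>A\<close> of the multiples of the
  evaluation at \<open>0\<close>. A relation then says that a combination with nonzero coefficients of \<open>l\<close> evaluations
  vanishes, so every evaluation point occurs at least twice, while cyclically consecutive points differ;
  this is impossible for \<open>l = 3\<close> and \<open>l = 5\<close>.\<close>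

section \<open>Paths in a cycle with a chord\<close>

text \<open>Here \<open>\<chi>\<close> is a colouring of a cycle of length \<open>m\<close> with a chord from \<open>0\<close> to \<open>r\<close>, unrolled to a
  periodic function on the integers. The last five assumptions say that paths of length \<open>L\<close> have ends of
  the same colour, for paths inside the cycle and for the four ways of leaving the ends of the chord.
  If the chord spans less than one period, these paths give a smaller period; otherwise the
  compositions of the reflections \<open>x \<mapsto> r - 1 - x\<close> and \<open>x \<mapsto> r + 1 - x\<close> give the period \<open>2\<close>.\<close>

lemma period_reflection_contradiction:
  fixes \<chi> :: "int \<Rightarrow> bool" and m L r :: int
  assumes "\<And>x. \<chi> (x + m) = \<chi> x" "even m"
    and even: "\<And>x. \<chi> x \<Longrightarrow> even x" and "\<chi> a" "\<not> \<chi> b" "even b"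
    and r: "1 < r" "r < m - 1" "odd r" and L: "0 < L" "L < m"
    and shift: "\<And>x. \<chi> (x + L) = \<chi> x"
    and out_out: "\<And>j. 0 \<le> j \<Longrightarrow> j < L \<Longrightarrow> L \<le> m - r \<Longrightarrow> \<chi> (- j) = \<chi> (r + (L - 1 - j))"
    and in_in: "\<And>j. 0 \<le> j \<Longrightarrow> j < L \<Longrightarrow> L \<le> r \<Longrightarrow> \<chi> j = \<chi> (r - (L - 1 - j))"
    and in_out: "\<And>j. 0 \<le> j \<Longrightarrow> j < L \<Longrightarrow> j < r \<Longrightarrow> L - 1 - j < m - r \<Longrightarrow> \<chi> j = \<chi> (r + (L - 1 - j))"
    and out_in: "\<And>j. 0 \<le> j \<Longrightarrow> j < L \<Longrightarrow> j < m - r \<Longrightarrow> L - 1 - j < r \<Longrightarrow> \<chi> (- j) = \<chi> (r - (L - 1 - j))"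
  shows False
proof -
  define per where "per s \<longleftrightarrow> (\<forall>x. \<chi> (x + s) = \<chi> x)" for s
  have per_add: "per (s + s')" if "per s" "per s'" for s s'
    using that unfolding per_def by (metis add.assoc)
  have per_minus: "per (- s)" if "per s" for s
    using that unfolding per_def by (metis diff_add_cancel uminus_add_conv_diff add.commute)
  have per_mult_nat: "per (s * int n)" if "per s" for s n
    by (induction n) (use that per_add in \<open>auto simp: distrib_left per_def[of 0]\<close>)
  have per_mult: "per (s * c)" if "per s" for s c
    using per_mult_nat[OF that, of "nat c"] per_minus[OF per_mult_nat[OF that, of "nat (- c)"]]
    by (cases "c \<ge> 0") auto
  have perm: "per m" and perL: "per L" using assms(1) shift by (simp_all add: per_def)
  \<comment> \<open>The least positive period; every period is a multiple of it, which bounds it by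
    both \<open>L\<close> and \<open>m - L\<close>.\<close>
  define t where "t = int (LEAST n. n > 0 \<and> per (int n))"
  have "nat L > 0 \<and> per (int (nat L))" using L perL by simp
  then have t: "t > 0" "per t"
    unfolding t_def by (metis (mono_tags, lifting) LeastI of_nat_0_less_iff)+
  have min: "\<not> per s" if "0 < s" "s < t" for s
  proof
    assume "per s"
    then have "nat s > 0 \<and> per (int (nat s))" using that by simp
    then have "(LEAST n. n > 0 \<and> per (int n)) \<le> nat s" by (rule Least_le)
    then show False using that unfolding t_def by linarith
  qed
  have dvd: "t dvd s" if "per s" for s
  proof -
    have "per (s + - (t * (s div t)))" by (intro per_add per_minus per_mult that t)
    moreover have "s + - (t * (s div t)) = s mod t" by (simp add: minus_mult_div_eq_mod)
    ultimately have "\<not> 0 < s mod t" using min[of "s mod t"] t(1) by auto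
    then have "s mod t = 0" using t(1) pos_mod_sign[of t s] by linarith
    then show ?thesis by (simp add: dvd_eq_mod_eq_0)
  qed
  have "\<chi> (a + t)" using t(2) assms(4) by (simp add: per_def)
  then have "even t" using even assms(4) by (metis even_add)
  have "\<not> per 2"
  proof
    assume "per 2"
    have "even (b - a)" using even assms(4,6) by auto
    then obtain c where "b = a + 2 * c" by (metis evenE diff_add_cancel add.commute)
    then show False using per_mult[OF \<open>per 2\<close>, of c] assms(4,5) by (simp add: per_def)
  qed
  then have "t \<noteq> 2" using t by blast
  with \<open>even t\<close> t(1) have t2: "t > 2" by presburger
  have "t dvd m - L" using dvd[OF perm] dvd[OF perL] by simp
  then have tm: "t \<le> m - L" using L by (intro zdvd_imp_le) simp_all
  have tL: "t \<le> L" using dvd[OF perL] L by (intro zdvd_imp_le) simp_all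
  have \<chi>_mod: "\<chi> x = \<chi> (u + (x - u) mod t)" for x u
  proof -
    have "\<chi> (u + (x - u) mod t + t * ((x - u) div t)) = \<chi> (u + (x - u) mod t)"
      using per_mult[OF t(2)] unfolding per_def by blast
    then show ?thesis by (simp add: add.assoc)
  qed
  have translate: "per s" if "\<And>x. u \<le> x \<Longrightarrow> x < u + t \<Longrightarrow> \<chi> (x + s) = \<chi> x" for u s
    unfolding per_def
  proof
    fix x
    have "\<chi> (x + s) = \<chi> (u + (x - u) mod t + s)"
      using \<chi>_mod[of "x + s" "u + s"] by (simp add: algebra_simps)
    then show "\<chi> (x + s) = \<chi> x"
      using that[of "u + (x - u) mod t"] \<chi>_mod[of x u] t(1) by simp
  qed
  have reflect: "\<chi> x = \<chi> (c - x)" if "\<And>x. u \<le> x \<Longrightarrow> x < u + t \<Longrightarrow> \<chi> x = \<chi> (c - x)" for u c x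
  proof -
    have "\<chi> (c - x) = \<chi> (c - x + t * ((x - u) div t))"
      using per_mult[OF t(2)] unfolding per_def by blast
    also have "c - x + t * ((x - u) div t) = c - (u + (x - u) mod t)"
      by (simp add: minus_mult_div_eq_mod[symmetric])
    finally show ?thesis
      using that[of "u + (x - u) mod t"] \<chi>_mod[of x u] t(1) by simp
  qed
  \<comment> \<open>Periodicity removes \<open>L\<close> from the path assumptions: they become
    translations by \<open>r - 1\<close> and \<open>r + 1\<close> and two reflections, each valid on
    a window of length \<open>t\<close>.\<close>
  have shiftL: "\<chi> (y + (L - z)) = \<chi> (y - z)" "\<chi> (y - (L - z)) = \<chi> (y + z)" for y z
    using shift[of "y - z"] shift[of "y - (L - z)"] by (simp_all add: algebra_simps)
  \<comment> \<open>If an arc cut off by the chord is shorter than \<open>t\<close>, a translation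
    gives a positive period below \<open>t\<close>: \<open>r - 1\<close>, or \<open>r + 1\<close>
    and hence \<open>m - r - 1\<close>.\<close>
  consider "r < t" | "m - r < t" | "t \<le> r" "t \<le> m - r" by linarith
  then show False
  proof cases
    case 1
    have "per (r - 1)"
    proof (rule translate)
      fix x assume "1 - t \<le> x" "x < 1 - t + t"
      then show "\<chi> (x + (r - 1)) = \<chi> x"
        using out_out[of "- x"] shiftL(1)[of r "1 - x"] 1 tm tL by (simp add: algebra_simps)
    qed
    then show False using min[of "r - 1"] r 1 by simp
  next
    case 2
    have "per (r + 1)"
    proof (rule translate)
      fix x assume "0 \<le> x" "x < 0 + t"
      then show "\<chi> (x + (r + 1)) = \<chi> x"
        using in_in[of x] shiftL(2)[of r "1 + x"] 2 tm tL by (simp add: algebra_simps)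
    qed
    then have "per (m + - (r + 1))" using per_add[OF perm per_minus] by blast
    then show False using min[of "m + - (r + 1)"] r 2 by simp
  next
    case 3
    have refl1: "\<chi> x = \<chi> (r - 1 - x)" for x
    proof (rule reflect)
      \<comment> \<open>\<open>in_out\<close> applies to \<open>j\<close> from this start up to
        \<open>min L r\<close>, exclusively; this interval contains a full period as
        \<open>t\<close> is at most \<open>L\<close>, \<open>r\<close>, \<open>m - r\<close> and
        \<open>m - L\<close>.\<close>
      fix x assume "max 0 (L - (m - r)) \<le> x" "x < max 0 (L - (m - r)) + t"
      then show "\<chi> x = \<chi> (r - 1 - x)"
        using in_out[of x] shiftL(1)[of r "1 + x"] 3 tm tL by (simp add: algebra_simps)
    qed
    have refl2: "\<chi> x = \<chi> (r + 1 - x)" for x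
    proof (rule reflect)
      fix x assume "- max 0 (L - r) - t + 1 \<le> x" "x < - max 0 (L - r) - t + 1 + t"
      then show "\<chi> x = \<chi> (r + 1 - x)"
        using out_in[of "- x"] shiftL(2)[of r "1 - x"] 3 tm tL by (simp add: algebra_simps)
    qed
    have "per 2"
      unfolding per_def using refl1 refl2 by (metis diff_diff_eq2 add.commute add_diff_cancel_left' diff_add_eq one_add_one add.assoc)
    then show False using \<open>\<not> per 2\<close> by simp
  qed
qed

text \<open>If no such path left \<open>A\<close>, the indicator of \<open>A\<close> along the cycle
  would be a colouring excluded by the preceding lemma: runs along the cycle give the period
  \<open>L\<close>, and runs through the chord give the four remaining relations.\<close>

lemma theta_path:
  fixes C :: "int \<Rightarrow> 'a" and m r :: int and L :: nat
  assumes C_eq: "\<And>x y. C x = C y \<longleftrightarrow> x mod m = y mod m"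
    and sym: "\<And>u v. adj u v \<Longrightarrow> adj v u"
    and step: "\<And>x. adj (C x) (C (x + 1))" and chord: "adj (C 0) (C r)"
    and m: "even m" and r: "1 < r" "r < m - 1" "odd r" and L: "even L" "0 < L" "int L < m"
    and A: "\<And>x. C x \<in> A \<Longrightarrow> even x" "C a \<in> A" "C b \<notin> A" "even b"
  shows "\<exists>ws. length ws = Suc L \<and> distinct ws \<and> successively adj ws \<and> set ws \<subseteq> range C \<and>
    hd ws \<in> A \<and> last ws \<notin> A"
proof (rule ccontr)
  assume no: "\<not> ?thesis"
  have adj: "adj (C x) (C y)" if "y = x + 1 \<or> x = y + 1 \<or> x = 0 \<and> y = r" for x y
    using that step chord sym by auto
  \<comment> \<open>An injective walk on the integers inside a window of length \<open>m\<close>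
    becomes a path of distinct vertices. As paths can be reversed, the colours of the ends
    agree.\<close>
  have path: "(C x \<in> A) = (C y \<in> A)"
    if inj: "inj_on f {..L}" and win: "\<And>i. i \<le> L \<Longrightarrow> u \<le> f i \<and> f i < u + m"
      and st: "\<And>i. i < L \<Longrightarrow> f (Suc i) = f i + 1 \<or> f i = f (Suc i) + 1 \<or> f i = 0 \<and> f (Suc i) = r"
      and xy: "x = f 0" "y = f L"
    for f u x y
  proof -
    define ws where "ws = map (\<lambda>i. C (f i)) [0..<Suc L]"
    have "inj_on (\<lambda>i. C (f i)) {..L}"
    proof (rule inj_onI)
      fix i i' assume i: "i \<in> {..L}" "i' \<in> {..L}" and "C (f i) = C (f i')"
      then have "(f i - u) mod m = (f i' - u) mod m" by (metis C_eq mod_diff_left_eq)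
      then have "f i = f i'" using win[of i] win[of i'] i by simp
      then show "i = i'" using inj i by (auto dest: inj_onD)
    qed
    moreover have "{..L} = set [0..<Suc L]" by auto
    ultimately have d: "distinct ws" by (simp add: ws_def distinct_map del: upt_Suc)
    have s: "successively adj ws"
      unfolding successively_conv_nth
    proof (intro allI impI)
      fix i assume "Suc i < length ws"
      then have "i < L" by (simp add: ws_def)
      then have "ws ! i = C (f i)" "ws ! Suc i = C (f (Suc i))" by (simp_all add: ws_def del: upt_Suc)
      then show "adj (ws ! i) (ws ! Suc i)" using adj st[OF \<open>i < L\<close>] by simp
    qed
    have len: "length ws = Suc L" and set: "set ws \<subseteq> range C" by (auto simp: ws_def)
    have hd: "hd ws = C x" and last: "last ws = C y"
      by (simp_all add: ws_def xy last_map hd_map del: upt_Suc)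
    have "successively (\<lambda>x y. adj y x) ws" by (rule successively_mono[OF s]) (rule sym)
    then have "successively adj (rev ws)" by simp
    moreover have "hd (rev ws) = C y" "last (rev ws) = C x"
      using hd last len by (auto simp: hd_rev last_rev)
    ultimately show ?thesis
      using no d s len set hd last by (metis distinct_rev length_rev set_rev)
  qed
  show False
  proof (rule period_reflection_contradiction[of "\<lambda>x. C x \<in> A" m a b r "int L"])
    show "(C (x + m) \<in> A) = (C x \<in> A)" for x
    proof -
      have "C (x + m) = C x" by (simp add: C_eq)
      then show ?thesis by simp
    qed
    show "(C (x + int L) \<in> A) = (C x \<in> A)" for x
      by (rule path[of "\<lambda>i. x + int (L - i)" x]) (use L in \<open>auto simp: inj_on_def\<close>)
    \<comment> \<open>The remaining walks take \<open>j\<close> steps to \<open>0\<close>, cross the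
      chord to \<open>r\<close> and spend the other \<open>L - 1 - j\<close> steps beyond it; the
      side conditions keep both parts disjoint and inside one window.\<close>
    show "(C (- j) \<in> A) = (C (r + (int L - 1 - j)) \<in> A)" if "0 \<le> j" "j < int L" "int L \<le> m - r" for j
      by (rule path[of "\<lambda>i. if int i \<le> j then int i - j else r + (int i - j - 1)" "- j"])
        (use that L r in \<open>auto simp: inj_on_def\<close>)
    show "(C j \<in> A) = (C (r - (int L - 1 - j)) \<in> A)" if "0 \<le> j" "j < int L" "int L \<le> r" for j
      by (rule path[of "\<lambda>i. if int i \<le> j then j - int i else r - (int i - j - 1)" 0])
        (use that L r in \<open>auto simp: inj_on_def\<close>)
    show "(C j \<in> A) = (C (r + (int L - 1 - j)) \<in> A)"
      if "0 \<le> j" "j < int L" "j < r" "int L - 1 - j < m - r" for j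
      by (rule path[of "\<lambda>i. if int i \<le> j then j - int i else r + (int i - j - 1)" 0])
        (use that L r in \<open>auto simp: inj_on_def\<close>)
    show "(C (- j) \<in> A) = (C (r - (int L - 1 - j)) \<in> A)"
      if "0 \<le> j" "j < int L" "j < m - r" "int L - 1 - j < r" for j
      by (rule path[of "\<lambda>i. if int i \<le> j then int i - j else r - (int i - j - 1)" "- j"])
        (use that L r in \<open>auto simp: inj_on_def\<close>)
  qed (use assms in auto)
qed

section \<open>Even cycles in dense graphs\<close>

text \<open>Among the subsets \<open>W\<close> spanning more than \<open>d * card W\<close> edges
  take a smallest one: deleting a vertex of degree at most \<open>d\<close> would preserve the
  inequality.\<close>

lemma min_degree_subset:
  assumes "finite V" and E: "\<And>e. e \<in> E \<Longrightarrow> card e = 2" and "d * card V < card {e \<in> E. e \<subseteq> V}"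
  obtains W where "W \<subseteq> V" "W \<noteq> {}" "\<forall>v\<in>W. d < card {u \<in> W. {v, u} \<in> E}"
proof -
  define P where "P W \<longleftrightarrow> W \<subseteq> V \<and> d * card W < card {e \<in> E. e \<subseteq> W}" for W
  obtain W where W: "P W" "\<And>W'. P W' \<Longrightarrow> card W \<le> card W'"
    using ex_has_least_nat[of P V card] assms(3) by (auto simp: P_def)
  have finW: "finite W" using W(1) assms(1) finite_subset by (auto simp: P_def)
  have "\<forall>v\<in>W. d < card {u \<in> W. {v, u} \<in> E}"
  proof
    fix v assume v: "v \<in> W"
    show "d < card {u \<in> W. {v, u} \<in> E}"
  proof (rule ccontr)
    assume less: "\<not> ?thesis"
    have "{e \<in> E. e \<subseteq> W} \<subseteq> {e \<in> E. e \<subseteq> W - {v}} \<union> (\<lambda>u. {v, u}) ` {u \<in> W. {v, u} \<in> E}"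
    proof
      fix e assume e: "e \<in> {e \<in> E. e \<subseteq> W}"
      then have "card e = 2" using E by blast
      then obtain x y where "e = {x, y}" by (auto simp: card_2_iff)
      then show "e \<in> {e \<in> E. e \<subseteq> W - {v}} \<union> (\<lambda>u. {v, u}) ` {u \<in> W. {v, u} \<in> E}"
        using e by (cases "x = v"; cases "y = v") (auto simp: insert_commute)
    qed
    then have "card {e \<in> E. e \<subseteq> W} \<le> card ({e \<in> E. e \<subseteq> W - {v}} \<union> (\<lambda>u. {v, u}) ` {u \<in> W. {v, u} \<in> E})"
      by (rule card_mono[rotated]) (use finW in \<open>auto intro: finite_subset[of _ "Pow W"]\<close>)
    also have "\<dots> \<le> card {e \<in> E. e \<subseteq> W - {v}} + card ((\<lambda>u. {v, u}) ` {u \<in> W. {v, u} \<in> E})"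
      by (rule card_Un_le)
    also have "card ((\<lambda>u. {v, u}) ` {u \<in> W. {v, u} \<in> E}) \<le> card {u \<in> W. {v, u} \<in> E}"
      by (rule card_image_le) (use finW in simp)
    finally have "card {e \<in> E. e \<subseteq> W} \<le> card {e \<in> E. e \<subseteq> W - {v}} + card {u \<in> W. {v, u} \<in> E}"
      by simp
    moreover have "card W = Suc (card (W - {v}))"
      using card_Suc_Diff1[OF finW v] by simp
    ultimately have "P (W - {v})" using W(1) less by (auto simp: P_def)
    from W(2)[OF this] \<open>card W = Suc (card (W - {v}))\<close> show False by simp
    qed
  qed
  moreover have "W \<noteq> {}"
  proof
    assume "W = {}"
    moreover have "{e \<in> E. e \<subseteq> {}} = {}" using E by fastforce
    moreover have "0 < card {e \<in> E. e \<subseteq> W}" using W(1) by (simp add: P_def)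
    ultimately show False by (metis card.empty less_irrefl)
  qed
  ultimately show ?thesis using that W(1) by (auto simp: P_def)
qed

text \<open>Vertices are added one at a time; each goes to the side that cuts at least half of its
  edges to the earlier vertices.\<close>

lemma large_cut:
  assumes "finite V" and "\<And>e. e \<in> E \<Longrightarrow> card e = 2 \<and> e \<subseteq> V"
  shows "\<exists>A\<subseteq>V. card E \<le> 2 * card {e \<in> E. e \<inter> A \<noteq> {} \<and> \<not> e \<subseteq> A}"
  using assms
proof (induction V arbitrary: E rule: finite_induct)
  case empty
  then have "E = {}" by fastforce
  then show ?case by simp
next
  case (insert x V)
  define cut where "cut A e \<longleftrightarrow> e \<inter> A \<noteq> {} \<and> \<not> e \<subseteq> A" for A and e :: "'a set"
  define E1 E2 where "E1 = {e \<in> E. x \<notin> e}" and "E2 = {e \<in> E. x \<in> e}"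
  have "card e = 2 \<and> e \<subseteq> V" if "e \<in> E1" for e
    using that insert.prems[of e] by (auto simp: E1_def)
  from insert.IH[OF this] obtain A where A: "A \<subseteq> V" "card E1 \<le> 2 * card {e \<in> E1. cut A e}"
    unfolding cut_def by blast
  have "E \<subseteq> Pow (insert x V)" using insert.prems by blast
  then have fin: "finite E" using insert.hyps by (meson finite_Pow_iff finite_insert finite_subset)
  have x: "x \<notin> A" using A(1) insert.hyps by blast
  have "E1 \<inter> E2 = {}" "E = E1 \<union> E2" by (auto simp: E1_def E2_def)
  moreover have fin12: "finite E1" "finite E2" using fin by (auto simp: E1_def E2_def)
  ultimately have cardE: "card {e \<in> E. P e} = card {e \<in> E1. P e} + card {e \<in> E2. P e}" for P
    by (subst card_Un_disjoint[symmetric]) (auto intro: arg_cong[where f = card])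
  have "cut A e \<or> cut (insert x A) e" if "e \<in> E2" for e
  proof -
    have "card e = 2" using insert.prems that by (auto simp: E2_def)
    then obtain u w where uw: "e = {u, w}" "u \<noteq> w" by (auto simp: card_2_iff)
    then show ?thesis using that x by (auto simp: E2_def cut_def)
  qed
  then have "E2 \<subseteq> {e \<in> E2. cut A e} \<union> {e \<in> E2. cut (insert x A) e}" by blast
  then have "card E2 \<le> card ({e \<in> E2. cut A e} \<union> {e \<in> E2. cut (insert x A) e})"
    by (rule card_mono[rotated]) (use fin12 in simp)
  then have "card E2 \<le> card {e \<in> E2. cut A e} + card {e \<in> E2. cut (insert x A) e}"
    using card_Un_le order_trans by blast
  moreover have "{e \<in> E1. cut (insert x A) e} = {e \<in> E1. cut A e}"
    by (auto simp: E1_def cut_def)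
  ultimately have "card E \<le> 2 * card {e \<in> E. cut A e} \<or> card E \<le> 2 * card {e \<in> E. cut (insert x A) e}"
    using cardE[of "cut A"] cardE[of "cut (insert x A)"] cardE[of "\<lambda>_. True"] A(2) by simp linarith
  then show ?case using A(1) unfolding cut_def by blast
qed

text \<open>The end of a longest path has all its neighbours on the path; the farthest one closes the
  cycle and another one gives the chord.\<close>

lemma theta_exists:
  assumes W: "finite W" "W \<noteq> {}" and sym: "\<And>u v. adj u v \<Longrightarrow> adj v u"
    and col: "\<And>u v. adj u v \<Longrightarrow> col u \<noteq> col v"
    and deg: "\<And>v. v \<in> W \<Longrightarrow> d \<le> card {u \<in> W. adj v u}" and d: "d \<ge> 3"
  obtains C :: "int \<Rightarrow> 'a" and m r where "\<forall>x y. C x = C y \<longleftrightarrow> x mod m = y mod m"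
    and "\<forall>x. adj (C x) (C (x + 1))" and "adj (C 0) (C r)"
    and "even m" and "1 < r" "r < m - 1" "odd r" and "2 * int d \<le> m"
    and "range C \<subseteq> W" and "\<forall>x. col (C x) \<longleftrightarrow> even x"
proof -
  define P where "P xs \<longleftrightarrow> xs \<noteq> [] \<and> distinct xs \<and> successively adj xs \<and> set xs \<subseteq> W" for xs
  obtain w where "w \<in> W" using W by blast
  then have "P [w]" by (simp add: P_def)
  moreover have "length xs < Suc (card W)" if "P xs" for xs
    using that W(1) by (metis P_def card_mono distinct_card le_imp_less_Suc)
  ultimately obtain xs where xs: "P xs" "\<And>ys. P ys \<Longrightarrow> length ys \<le> length xs"
    using ex_has_greatest_nat[of P "[w]" length "Suc (card W)"] by (metis)
  have pos: "0 < length xs" using xs(1) by (simp add: P_def)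
  define J where "J = {j. j < length xs \<and> adj (xs ! 0) (xs ! j)}"
  have "{u \<in> W. adj (xs ! 0) u} \<subseteq> (!) xs ` J"
  proof
    fix u assume u: "u \<in> {u \<in> W. adj (xs ! 0) u}"
    have "u \<in> set xs"
    proof (rule ccontr)
      assume "u \<notin> set xs"
      then have "P (u # xs)"
        using xs(1) u sym by (auto simp: P_def successively_Cons hd_conv_nth)
      from xs(2)[OF this] show False by simp
    qed
    then show "u \<in> (!) xs ` J" using u by (auto simp: in_set_conv_nth J_def)
  qed
  moreover have finJ: "finite J" by (simp add: J_def)
  ultimately have "card {u \<in> W. adj (xs ! 0) u} \<le> card J"
    by (meson card_image_le card_mono finite_imageI order_trans)
  moreover have "xs ! 0 \<in> W" using xs(1) pos by (auto simp: P_def)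
  ultimately have cardJ: "d \<le> card J" using deg[of "xs ! 0"] by linarith
  have adjS: "adj (xs ! j) (xs ! Suc j)" if "Suc j < length xs" for j
    using that xs(1) by (auto simp: P_def successively_conv_nth)
  \<comment> \<open>Colours alternate along the path, so the neighbours of its first vertex sit at
    odd positions. Only half of the positions up to \<open>p\<close> are odd, whence a cycle of
    length at least \<open>2 * d\<close>.\<close>
  have colj: "col (xs ! j) \<longleftrightarrow> (col (xs ! 0) \<noteq> odd j)" if "j < length xs" for j
    using that
  proof (induction j)
    case (Suc j)
    then show ?case using col[OF adjS[of j]] by auto
  qed simp
  have oddJ: "odd j" if "j \<in> J" for j
    using that colj[of j] col[of "xs ! 0" "xs ! j"] by (auto simp: J_def)
  define p where "p = Max J"
  have "J \<noteq> {}" using cardJ d by auto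
  then have pJ: "p \<in> J" and ple: "\<And>j. j \<in> J \<Longrightarrow> j \<le> p"
    using finJ by (auto simp: p_def)
  have "card J \<le> card {..<Suc p div 2}"
  proof (rule card_inj_on_le)
    show "inj_on (\<lambda>j. j div 2) J"
      by (rule inj_onI) (metis oddJ odd_two_times_div_two_succ)
    show "(\<lambda>j. j div 2) ` J \<subseteq> {..<Suc p div 2}"
    proof safe
      fix j assume "j \<in> J"
      then have "odd j" "j \<le> p" "odd p" using oddJ ple pJ by auto
      then show "j div 2 < Suc p div 2" by presburger
    qed
  qed simp
  then have dp: "2 * d \<le> Suc p" using cardJ by simp
  have "\<not> J \<subseteq> {1, p}"
  proof
    assume "J \<subseteq> {1, p}"
    then have "card J \<le> card {1, p}" by (intro card_mono) auto
    also have "\<dots> \<le> 2" by (simp add: card_insert_if)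
    finally show False using cardJ d by simp
  qed
  then obtain r where r: "r \<in> J" "r \<noteq> 1" "r \<noteq> p" by blast
  have r': "1 < r" "r < p" "odd r" using oddJ[OF r(1)] ple[OF r(1)] r by (auto elim!: oddE)
  have plen: "p < length xs" using pJ by (simp add: J_def)
  define m where "m = int (Suc p)"
  have m: "m > 0" "even m" using oddJ[OF pJ] by (auto simp: m_def)
  define C where "C x = xs ! nat (x mod m)" for x
  have mod: "nat (x mod m) \<le> p" "x mod m < m" "0 \<le> x mod m" for x
  proof -
    show "x mod m < m" "0 \<le> x mod m" using m(1) by simp_all
    then show "nat (x mod m) \<le> p" unfolding m_def by linarith
  qed
  have C_eq: "C x = C y \<longleftrightarrow> x mod m = y mod m" for x y
  proof -
    have "C x = C y \<longleftrightarrow> nat (x mod m) = nat (y mod m)"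
      unfolding C_def using xs(1) plen mod[of x] mod[of y] by (subst nth_eq_iff_index_eq) (auto simp: P_def)
    then show ?thesis using mod(3) by (metis eq_nat_nat_iff)
  qed
  have C_step: "adj (C x) (C (x + 1))" for x
  proof (cases "x mod m = int p")
    case True
    then have "(x + 1) mod m = (int p + 1) mod m" by (metis mod_add_left_eq)
    moreover have "int p + 1 = m" by (simp add: m_def)
    ultimately have "(x + 1) mod m = 0" by simp
    then show ?thesis using True pJ sym by (simp add: C_def J_def)
  next
    case False
    then have lt: "x mod m + 1 < m" using mod[of x] by (auto simp: m_def)
    have "(x + 1) mod m = (x mod m + 1) mod m" by (metis mod_add_left_eq)
    then have "(x + 1) mod m = x mod m + 1" using lt mod[of x] by simp
    moreover from this have "nat ((x + 1) mod m) = Suc (nat (x mod m))" using mod[of x] by simp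
    moreover have "x mod m < int p" using lt by (simp add: m_def)
    then have "Suc (nat (x mod m)) < length xs" using plen mod(3)[of x] by linarith
    ultimately show ?thesis unfolding C_def using adjS by simp
  qed
  have C_r: "adj (C 0) (C (int r))"
    using r r' by (simp add: C_def J_def m_def)
  have C_W: "C x \<in> W" for x
    using xs(1) plen mod(1)[of x] by (auto simp: C_def P_def)
  have C_col: "col (C x) \<longleftrightarrow> (col (xs ! 0) \<noteq> odd x)" for x
  proof -
    have "odd (nat (x mod m)) \<longleftrightarrow> odd (x mod m)" using mod[of x] by (auto simp: even_nat_iff)
    also have "\<dots> \<longleftrightarrow> odd x" using m(2) by (simp add: dvd_mod_iff)
    finally show ?thesis unfolding C_def using colj[of "nat (x mod m)"] plen mod(1)[of x] by auto
  qed
  have rm: "1 < int r" "int r < m - 1" "odd (int r)" "2 * int d \<le> m"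
    using r' dp by (auto simp: m_def)
  show ?thesis
  proof (cases "col (xs ! 0)")
    case True
    moreover have "range C \<subseteq> W" using C_W by blast
    ultimately show ?thesis using that[OF _ _ C_r m(2) rm] C_eq C_step C_col by simp
  next
    case False
    \<comment> \<open>Reversing the cycle swaps the ends of the chord and, as \<open>r\<close> is
      odd, exchanges even and odd positions.\<close>
    define C' where "C' x = C (int r - x)" for x
    have 1: "C' x = C' y \<longleftrightarrow> x mod m = y mod m" for x y
    proof -
      have "(int r - x) mod m = (int r - y) mod m \<longleftrightarrow> m dvd (y - x)"
        by (simp add: mod_eq_dvd_iff)
      also have "\<dots> \<longleftrightarrow> x mod m = y mod m" by (metis mod_eq_dvd_iff)
      finally show ?thesis by (simp add: C'_def C_eq)
    qed
    have 2: "adj (C' x) (C' (x + 1))" for x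
      using sym[OF C_step[of "int r - (x + 1)"]] by (simp add: C'_def)
    have 3: "adj (C' 0) (C' (int r))" using sym[OF C_r] by (simp add: C'_def)
    have 4: "col (C' x) \<longleftrightarrow> even x" for x
      using False C_col[of "int r - x"] rm(3) by (auto simp: C'_def)
    have "range C' \<subseteq> W" using C_W by (auto simp: C'_def)
    then show ?thesis using that[OF _ _ 3 m(2) rm] 1 2 4 by simp
  qed
qed

section \<open>Cycles through the search tree\<close>

text \<open>Let \<open>s\<close> be the least number of steps to the root after which all vertices of level \<open>i\<close> on the
  cycle with a chord have the same ancestor. One step earlier the ancestors split these vertices into
  classes, and a path of length \<open>2l - 2s\<close> between different classes closes up through the tree.\<close>

lemma even_cycle_between_levels:
  fixes lev :: "'a \<Rightarrow> nat"
  assumes sym: "\<And>u v. adj u v \<Longrightarrow> adj v u"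
    and par: "\<And>v. v \<in> V \<Longrightarrow> lev v > 0 \<Longrightarrow> par v \<in> V \<and> adj v (par v) \<and> lev v = Suc (lev (par v))"
    and root: "\<And>v. v \<in> V \<Longrightarrow> lev v = 0 \<Longrightarrow> v = x"
    and W: "finite W" "W \<noteq> {}" "W \<subseteq> V" "\<And>v. v \<in> W \<Longrightarrow> lev v = i \<or> lev v = Suc i"
    and deg: "\<And>v. v \<in> W \<Longrightarrow> l \<le> card {u \<in> W. adj v u \<and> lev u \<noteq> lev v}"
    and l: "3 \<le> l" "i < l"
  shows "\<exists>ws. length ws = 2 * l \<and> distinct ws \<and> successively adj ws \<and> adj (last ws) (hd ws) \<and> set ws \<subseteq> V"
proof -
  define adj' where "adj' u v \<longleftrightarrow> adj u v \<and> lev u \<noteq> lev v \<and> u \<in> W \<and> v \<in> W" for u v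
  have sym': "adj' u v \<Longrightarrow> adj' v u" for u v
    unfolding adj'_def by (metis sym)
  have col': "adj' u v \<Longrightarrow> (lev u = i) \<noteq> (lev v = i)" for u v
    using W(4)[of u] W(4)[of v] by (auto simp: adj'_def)
  have deg': "l \<le> card {u \<in> W. adj' v u}" if "v \<in> W" for v
  proof -
    have "{u \<in> W. adj v u \<and> lev u \<noteq> lev v} = {u \<in> W. adj' v u}" using that by (auto simp: adj'_def)
    then show ?thesis using deg[OF that] by simp
  qed
  obtain C :: "int \<Rightarrow> 'a" and m r where C_eq: "\<forall>x y. C x = C y \<longleftrightarrow> x mod m = y mod m"
    and step: "\<forall>x. adj' (C x) (C (x + 1))" and chord: "adj' (C 0) (C r)"
    and m: "even m" and r: "1 < r" "r < m - 1" "odd r" and lm: "2 * int l \<le> m"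
    and CW: "range C \<subseteq> W" and Ccol: "\<forall>x. lev (C x) = i \<longleftrightarrow> even x"
    by (rule theta_exists[of W adj' "\<lambda>v. lev v = i" l, OF W(1,2) sym' col' deg' l(1)])
  define U where "U = {C x | x. even x}"
  have U: "u \<in> V \<and> lev u = i" if "u \<in> U" for u
    using that Ccol CW W(3) by (auto simp: U_def)
  have anc: "(par ^^ a) v \<in> V \<and> lev ((par ^^ a) v) = lev v - a" if "v \<in> V" "a \<le> lev v" for a v
    using that(2)
  proof (induction a)
    case (Suc a)
    then show ?case using par[of "(par ^^ a) v"] that(1) by simp arith
  qed (use that in simp)
  define const where "const s \<longleftrightarrow> (\<exists>z. \<forall>u\<in>U. (par ^^ s) u = z)" for s
  have "const i" unfolding const_def
  proof (intro exI[of _ x] ballI)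
    fix u assume "u \<in> U"
    then show "(par ^^ i) u = x" using U[of u] anc[of u i] root by simp
  qed
  define s where "s = (LEAST s. const s)"
  have s: "const s" "s \<le> i" unfolding s_def using \<open>const i\<close> by (auto intro: LeastI Least_le)
  have C02: "C 0 \<in> U" "C 2 \<in> U" unfolding U_def by force+
  have "C 0 \<noteq> C 2" using C_eq[rule_format, of 0 2] r by auto
  then have "\<not> const 0" using C02 unfolding const_def funpow_0 by metis
  then have s0: "s > 0" using s(1) by (cases s) auto
  define g where "g = par ^^ (s - 1)"
  have "\<not> const (s - 1)" using s0 not_less_Least[of "s - 1" const] by (simp add: s_def)
  then obtain b where b: "b \<in> U" "g b \<noteq> g (C 0)" by (auto simp: const_def g_def)
  then obtain b' where b': "b = C b'" "even b'" by (auto simp: U_def)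
  define A where "A = {u \<in> U. g u = g (C 0)}"
  \<comment> \<open>The route through the tree has \<open>2 * s\<close> edges. The rest is positive
    as \<open>s \<le> i < l\<close>, and below \<open>m\<close> as \<open>s > 0\<close> and
    \<open>2 * l \<le> m\<close>.\<close>
  define L where "L = 2 * l - 2 * s"
  have L: "even L" "0 < L" "int L < m" using s s0 l lm by (auto simp: L_def)
  have "\<exists>ws. length ws = Suc L \<and> distinct ws \<and> successively adj' ws \<and> set ws \<subseteq> range C \<and>
      hd ws \<in> A \<and> last ws \<notin> A"
  proof (rule theta_path[OF C_eq[rule_format] sym' step[rule_format] chord m r L, of A 0 b'])
    show "even x" if "C x \<in> A" for x
      using that Ccol U by (auto simp: A_def)
  qed (use b b' C02 in \<open>auto simp: A_def\<close>)
  then obtain ws where ws: "length ws = Suc L" "distinct ws" "successively adj' ws" "set ws \<subseteq> range C"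
    and hdA: "hd ws \<in> A" and lastA: "last ws \<notin> A" by blast
  define u w where "u = hd ws" and "w = last ws"
  have u: "u = ws ! 0" and w: "w = ws ! L" and ws_ne: "ws \<noteq> []"
    using ws(1) by (cases ws; auto simp: u_def w_def last_conv_nth)+
  have ws_lev: "lev (ws ! j) = i \<longleftrightarrow> even j" if "j \<le> L" for j
    using that
  proof (induction j)
    case 0
    have "ws ! 0 \<in> U" using hdA u by (simp add: u_def A_def)
    then show ?case using U by simp
  next
    case (Suc j)
    then show ?case
      using col'[OF successively_nth[OF ws(3), of j]] ws(1) by auto
  qed
  have uU: "u \<in> U" using hdA by (simp add: u_def A_def)
  \<comment> \<open>\<open>theta_path\<close> only places \<open>w\<close> outside \<open>A\<close>;
    the parity of \<open>L\<close> puts it on level \<open>i\<close>, hence in \<open>U\<close> but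
    in another class than \<open>u\<close>.\<close>
  have "lev w = i" using ws_lev[of L] L(1) w by simp
  moreover have "w \<in> range C" using ws(4) ws_ne by (auto simp: w_def)
  ultimately have wU: "w \<in> U" using Ccol by (auto simp: U_def)
  have g_neq: "g u \<noteq> g w" using hdA lastA wU by (auto simp: A_def u_def[symmetric] w_def[symmetric])
  have meet: "(par ^^ s) u = (par ^^ s) w" using s(1) uU wU by (auto simp: const_def)
  have disj: "(par ^^ a) u \<noteq> (par ^^ a) w" if "a < s" for a
  proof
    assume eq: "(par ^^ a) u = (par ^^ a) w"
    have "(par ^^ (s - 1)) v = (par ^^ (s - 1 - a)) ((par ^^ a) v)" for v
      using that by (metis Suc_pred' comp_apply funpow_add le_add_diff_inverse2 less_Suc_eq_le s0)
    with eq g_neq show False by (simp add: g_def)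
  qed
  have anc_u: "(par ^^ a) u \<in> V" "lev ((par ^^ a) u) = i - a" "a < i \<Longrightarrow> adj ((par ^^ a) u) ((par ^^ Suc a) u)"
    if "a \<le> i" for a
    using anc[of u a] par[of "(par ^^ a) u"] U[OF uU] that by auto
  have anc_w: "(par ^^ a) w \<in> V" "lev ((par ^^ a) w) = i - a" "a < i \<Longrightarrow> adj ((par ^^ a) w) ((par ^^ Suc a) w)"
    if "a \<le> i" for a
    using anc[of w a] par[of "(par ^^ a) w"] U[OF wU] that by auto
  \<comment> \<open>The inner vertices of the tree route: up from \<open>w\<close> to the common
    ancestor, reached at \<open>t = s - 1\<close>, then down to the parent of
    \<open>u\<close>.\<close>
  define f where "f t = (if t < s then (par ^^ Suc t) w else (par ^^ (2 * s - 1 - t)) u)" for t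
  define ys where "ys = map f [0..<2 * s - 1]"
  have ys: "length ys = 2 * s - 1" "\<And>t. t < 2 * s - 1 \<Longrightarrow> ys ! t = f t" by (simp_all add: ys_def)
  have f_lev: "lev (f t) = (if t < s then i - Suc t else i - (2 * s - 1 - t))" "f t \<in> V" if "t < 2 * s - 1" for t
    using that anc_u anc_w s by (auto simp: f_def simp del: funpow.simps)
  have "distinct ys"
    unfolding ys_def distinct_map
  proof
    show "inj_on f (set [0..<2 * s - 1])"
    proof (rule inj_onI)
      fix t t' assume "t \<in> set [0..<2 * s - 1]" "t' \<in> set [0..<2 * s - 1]" and eq: "f t = f t'"
      then have t: "t < 2 * s - 1" "t' < 2 * s - 1" by auto
      have neq: "f a \<noteq> f b" if "a < s" "s \<le> b" "b < 2 * s - 1" for a b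
      proof
        assume e: "f a = f b"
        then have "i - Suc a = i - (2 * s - 1 - b)" using f_lev(1)[of a] f_lev(1)[of b] that by simp
        then have "Suc a = 2 * s - 1 - b" using that s by linarith
        moreover from this have "Suc a < s" using that by linarith
        ultimately show False using e disj[of "Suc a"] that by (simp add: f_def del: funpow.simps)
      qed
      have "(t < s) = (t' < s)" using neq[of t t'] neq[of t' t] eq t by (metis not_le)
      moreover have "lev (f t) = lev (f t')" using eq by simp
      ultimately show "t = t'"
        using f_lev(1)[OF t(1)] f_lev(1)[OF t(2)] t s by (simp split: if_splits)
    qed
  qed simp
  moreover have "set ws \<inter> set ys = {}"
  proof -
    have "lev v \<ge> i" if "v \<in> set ws" for v
    proof -
      have "v \<in> W" using that ws(4) CW by blast
      then show ?thesis using W(4)[of v] by auto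
    qed
    moreover have "lev v < i" if v: "v \<in> set ys" for v
    proof -
      obtain t where "t < 2 * s - 1" "v = f t" using v unfolding ys_def by auto
      then show ?thesis using f_lev(1)[of t] s s0 by (simp split: if_splits)
    qed
    ultimately show ?thesis by (meson disjoint_iff not_le)
  qed
  ultimately have dist: "distinct (ws @ ys)" using ws(2) by simp
  have "successively adj ys"
    unfolding successively_conv_nth
  proof (intro allI impI)
    fix t assume "Suc t < length ys"
    then have t: "Suc t < 2 * s - 1" by (simp add: ys)
    consider "Suc t < s" | "Suc t = s" | "s < Suc t" by linarith
    then have "adj (f t) (f (Suc t))"
    proof cases
      case 1
      then show ?thesis using anc_w(3)[of "Suc t"] s by (simp add: f_def)
    next
      case 2
      then have "2 * s - 1 - Suc t = s - 1" "Suc (s - 1) = s" by auto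
      then have "f (Suc t) = (par ^^ (s - 1)) u" "f t = (par ^^ Suc (s - 1)) u"
        using 2 meet by (simp_all add: f_def del: funpow.simps)
      then show ?thesis using sym[OF anc_u(3)[of "s - 1"]] s s0 by simp
    next
      case 3
      then have e: "2 * s - 1 - t = Suc (2 * s - 1 - Suc t)" using t by simp
      have "f t = (par ^^ Suc (2 * s - 1 - Suc t)) u" "f (Suc t) = (par ^^ (2 * s - 1 - Suc t)) u"
        using 3 e by (simp_all add: f_def del: funpow.simps)
      moreover have "2 * s - 1 - Suc t < i" using 3 s s0 by linarith
      ultimately show ?thesis using sym[OF anc_u(3)[of "2 * s - 1 - Suc t"]] by (simp del: funpow.simps)
    qed
    then show "adj (ys ! t) (ys ! Suc t)" using t ys by simp
  qed
  moreover have "successively adj ws"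
    using ws(3) by (rule successively_mono) (auto simp: adj'_def)
  moreover have ys_ne: "ys \<noteq> []" using s0 by (auto simp: ys_def)
  moreover have "adj (last ws) (hd ys)"
  proof -
    have "hd ys = par w" using ys_ne s0 ys(2)[of 0] by (simp add: hd_conv_nth f_def)
    then show ?thesis using anc_w(3)[of 0] s s0 by (simp add: w_def)
  qed
  ultimately have succ: "successively adj (ws @ ys)" by (simp add: successively_append_iff)
  have "last ys = f (2 * s - 2)"
    using ys_ne s0 ys(2)[of "2 * s - 2"] ys(1) by (simp add: last_conv_nth numeral_2_eq_2)
  also have "\<dots> = par u"
    using meet s0 by (cases "s = 1") (auto simp: f_def numeral_2_eq_2 Suc_diff_le)
  finally have "adj (last (ws @ ys)) (hd (ws @ ys))"
    using ys_ne ws_ne anc_u(3)[of 0] s s0 sym by (simp add: u_def)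
  moreover have "length (ws @ ys) = 2 * l"
    using ws(1) ys(1) s s0 l by (simp add: L_def)
  moreover have "set (ws @ ys) \<subseteq> V"
    using ws(4) CW W(3) f_lev(2) by (auto simp: ys_def)
  ultimately show ?thesis using dist succ by blast
qed

text \<open>Breadth-first search from \<open>x\<close>: edges join consecutive levels only, and by
  the preceding lemma two consecutive levels up to level \<open>l\<close> span few edges, so large
  degrees force each level to be at least \<open>D\<close> times the previous one.\<close>

lemma bipartite_min_degree_bound:
  fixes adj :: "'a \<Rightarrow> 'a \<Rightarrow> bool" and col :: "'a \<Rightarrow> bool"
  assumes "finite V" and x: "x \<in> V" and sym: "\<And>u v. adj u v \<Longrightarrow> adj v u"
    and col: "\<And>u v. adj u v \<Longrightarrow> col u \<noteq> col v" and adj_V: "\<And>u v. adj u v \<Longrightarrow> v \<in> V"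
    and deg: "\<And>v. v \<in> V \<Longrightarrow> l * (D + 3) \<le> card {u. adj v u}" and "D \<ge> 1" "l \<ge> 3"
    and no_cycle: "\<not> (\<exists>ws. length ws = 2 * l \<and> distinct ws \<and> successively adj ws \<and>
      adj (last ws) (hd ws) \<and> set ws \<subseteq> V)"
  shows "D ^ l \<le> card V"
proof -
  define R where "R = {v. adj\<^sup>*\<^sup>* x v}"
  have "v \<in> V" if "adj\<^sup>*\<^sup>* x v" for v
    using that by (induction rule: rtranclp_induct) (use x adj_V in blast)+
  then have RV: "R \<subseteq> V" by (auto simp: R_def)
  have finR: "finite R" using finite_subset[OF RV assms(1)] .
  define lev where "lev v = (LEAST n. (adj ^^ n) x v)" for v
  have lev: "(adj ^^ lev v) x v" if v: "v \<in> R" for v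
  proof -
    obtain n where "(adj ^^ n) x v" using v rtranclp_imp_relpowp unfolding R_def by fast
    then show ?thesis unfolding lev_def by (rule LeastI)
  qed
  have lev_le: "lev v \<le> n" if "(adj ^^ n) x v" for v n
    unfolding lev_def using that by (rule Least_le)
  \<comment> \<open>The colour of its end fixes the parity of a walk from \<open>x\<close>, hence
    adjacent vertices are never on the same level.\<close>
  have col_pow: "col v \<longleftrightarrow> (col x \<noteq> odd n)" if "(adj ^^ n) x v" for v n
    using that
  proof (induction n arbitrary: v)
    case (Suc n)
    then obtain u where "(adj ^^ n) x u" "adj u v" by (auto elim: relpowp_Suc_E)
    then show ?case using Suc.IH[of u] col[of u v] by auto
  qed simp
  have step: "u \<in> R \<and> lev u \<le> Suc (lev v)" if "v \<in> R" "adj v u" for u v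
  proof
    show "u \<in> R" using that unfolding R_def by (auto intro: rtranclp.rtrancl_into_rtrancl)
    show "lev u \<le> Suc (lev v)" using lev[OF that(1)] that(2) by (intro lev_le relpowp_Suc_I)
  qed
  have levs: "lev u = Suc (lev v) \<or> lev v = Suc (lev u)" if v: "v \<in> R" "adj v u" for u v
  proof -
    have u: "u \<in> R" "lev u \<le> Suc (lev v)" using step[OF v] by auto
    have "lev v \<le> Suc (lev u)" using step[OF u(1) sym[OF v(2)]] by blast
    moreover have "lev u \<noteq> lev v"
      using col_pow[OF lev[OF v(1)]] col_pow[OF lev[OF u(1)]] col[OF v(2)] by metis
    ultimately show ?thesis using u(2) by linarith
  qed
  have "\<exists>u. u \<in> R \<and> adj v u \<and> lev v = Suc (lev u)" if v: "v \<in> R" "lev v > 0" for v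
  proof -
    obtain k where k: "lev v = Suc k" using v(2) by (cases "lev v") auto
    obtain u where u: "(adj ^^ k) x u" "adj u v"
      using lev[OF v(1)] unfolding k by (auto elim: relpowp_Suc_E)
    have "u \<in> R" using u(1) unfolding R_def by (auto intro: relpowp_imp_rtranclp)
    moreover have "lev v = Suc (lev u)" using lev_le[OF u(1)] step[OF calculation u(2)] k by linarith
    ultimately show ?thesis using sym[OF u(2)] by blast
  qed
  then obtain par where par: "\<And>v. v \<in> R \<Longrightarrow> lev v > 0 \<Longrightarrow> par v \<in> R \<and> adj v (par v) \<and> lev v = Suc (lev (par v))"
    by metis
  have root: "v = x" if "v \<in> R" "lev v = 0" for v
    using lev[OF that(1)] that(2) by simp
  define layer where "layer i = {v \<in> R. lev v = i}" for i
  have fin_layer: "finite (layer i)" for i using finR by (simp add: layer_def)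
  have xR: "x \<in> R" "lev x = 0" using lev_le[of 0 x] by (auto simp: R_def)
  have layer0: "layer 0 = {x}" unfolding layer_def using xR by (auto dest: root)
  define M where "M i = {(u, v). u \<in> layer i \<and> v \<in> layer (Suc i) \<and> adj u v}" for i
  have finM: "finite (M i)" for i
    by (rule finite_subset[of _ "layer i \<times> layer (Suc i)"]) (auto simp: M_def fin_layer)
  \<comment> \<open>Otherwise the edges between the two levels contain a subgraph of minimum degree
    above \<open>l\<close>, which yields a cycle of length \<open>2 * l\<close> through the search
    tree.\<close>
  have M_le: "card (M i) \<le> l * (card (layer i) + card (layer (Suc i)))" if "i < l" for i
  proof (rule ccontr)
    assume contr: "\<not> ?thesis"
    define E where "E = (\<lambda>(u, v). {u, v}) ` M i"
    have "inj_on (\<lambda>(u, v). {u, v}) (M i)"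
    proof (rule inj_onI, clarify)
      fix u v u' v' assume uv: "(u, v) \<in> M i" "(u', v') \<in> M i" "{u, v} = {u', v'}"
      then have "lev u \<noteq> lev v'" by (simp add: M_def layer_def)
      then show "u = u' \<and> v = v'" using uv(3) by (auto simp: doubleton_eq_iff)
    qed
    then have 1: "card E = card (M i)" unfolding E_def by (rule card_image)
    have 2: "card (layer i \<union> layer (Suc i)) = card (layer i) + card (layer (Suc i))"
      by (intro card_Un_disjoint fin_layer) (auto simp: layer_def)
    have 3: "{e \<in> E. e \<subseteq> layer i \<union> layer (Suc i)} = E" by (auto simp: E_def M_def)
    have large: "l * card (layer i \<union> layer (Suc i)) < card {e \<in> E. e \<subseteq> layer i \<union> layer (Suc i)}"
      unfolding 1 2 3 using contr by simp
    have card2: "card e = 2" if "e \<in> E" for e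
    proof -
      obtain u v where uv: "e = {u, v}" "u \<in> layer i" "v \<in> layer (Suc i)" using \<open>e \<in> E\<close> by (auto simp: E_def M_def)
      then have "u \<noteq> v" by (auto simp: layer_def)
      then show ?thesis using uv(1) by simp
    qed
    have fin: "finite (layer i \<union> layer (Suc i))" by (simp add: fin_layer)
    obtain W where W: "W \<subseteq> layer i \<union> layer (Suc i)" "W \<noteq> {}"
      and degW: "\<forall>v\<in>W. l < card {u \<in> W. {v, u} \<in> E}"
      by (rule min_degree_subset[OF fin card2 large])
    have finW: "finite W" using finite_subset[OF W(1)] fin_layer by simp
    have WR: "W \<subseteq> R" using W(1) by (auto simp: layer_def)
    have levW: "lev v = i \<or> lev v = Suc i" if "v \<in> W" for v using W(1) that by (auto simp: layer_def)
    have "l \<le> card {u \<in> W. adj v u \<and> lev u \<noteq> lev v}" if "v \<in> W" for v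
    proof -
      have "adj v u \<and> lev u \<noteq> lev v" if vu: "{v, u} \<in> E" for u
      proof -
        obtain a b where ab: "{v, u} = {a, b}" "adj a b" "lev a = i" "lev b = Suc i"
          using vu by (auto simp: E_def M_def layer_def)
        then have "v = a \<and> u = b \<or> v = b \<and> u = a" by (auto simp: doubleton_eq_iff)
        then show ?thesis using ab sym[OF ab(2)] by auto
      qed
      then have "card {u \<in> W. {v, u} \<in> E} \<le> card {u \<in> W. adj v u \<and> lev u \<noteq> lev v}"
        using finW by (intro card_mono) auto
      then show ?thesis using bspec[OF degW that] by linarith
    qed
    from even_cycle_between_levels[of adj R lev par x W i l, OF sym par root finW W(2) WR levW this \<open>l \<ge> 3\<close> that]
    show False using no_cycle RV by blast
  qed
  have deg_le: "l * (D + 3) * card (layer (Suc i)) \<le> card (M i) + card (M (Suc i))" for i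
  proof -
    have fin: "finite {u. adj v u}" for v
      by (rule finite_subset[OF _ assms(1)]) (use adj_V in blast)
    have "l * (D + 3) * card (layer (Suc i)) = (\<Sum>v\<in>layer (Suc i). l * (D + 3))" by simp
    also have "\<dots> \<le> (\<Sum>v\<in>layer (Suc i). card {u. adj v u})"
      using RV by (intro sum_mono deg) (auto simp: layer_def)
    also have "\<dots> = card (SIGMA v : layer (Suc i). {u. adj v u})"
      using fin_layer fin by simp
    also have "\<dots> \<le> card ((\<lambda>(u, v). (v, u)) ` M i \<union> M (Suc i))"
    proof (rule card_mono)
      show "(SIGMA v : layer (Suc i). {u. adj v u}) \<subseteq> (\<lambda>(u, v). (v, u)) ` M i \<union> M (Suc i)"
      proof
        fix p assume "p \<in> (SIGMA v : layer (Suc i). {u. adj v u})"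
        then obtain v u where p: "p = (v, u)" "v \<in> R" "lev v = Suc i" "adj v u" by (auto simp: layer_def)
        have "u \<in> R" using step[OF p(2,4)] by blast
        from levs[OF p(2,4)] show "p \<in> (\<lambda>(u, v). (v, u)) ` M i \<union> M (Suc i)"
        proof
          assume "lev u = Suc (lev v)"
          then have "p \<in> M (Suc i)" using p \<open>u \<in> R\<close> by (simp add: M_def layer_def)
          then show ?thesis by blast
        next
          assume "lev v = Suc (lev u)"
          then have "(u, v) \<in> M i" using p \<open>u \<in> R\<close> sym[OF p(4)] by (simp add: M_def layer_def)
          then show ?thesis using p(1) by (auto intro!: image_eqI[of _ _ "(u, v)"])
        qed
      qed
    qed (simp add: finM)
    also have "\<dots> \<le> card ((\<lambda>(u, v). (v, u)) ` M i) + card (M (Suc i))" by (rule card_Un_le)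
    also have "\<dots> \<le> card (M i) + card (M (Suc i))"
      using card_image_le[OF finM, of "\<lambda>(u, v). (v, u)" i] by simp
    finally show ?thesis .
  qed
  have growth: "D * card (layer i) \<le> card (layer (Suc i))" if "i < l" for i
    using that
  proof (induction i)
    case 0
    have "{u. adj x u} \<subseteq> layer (Suc 0)"
      using step[OF xR(1)] levs[OF xR(1)] xR(2) by (auto simp: layer_def)
    then have "card {u. adj x u} \<le> card (layer (Suc 0))" by (intro card_mono fin_layer)
    then have D1: "l * (D + 3) \<le> card (layer (Suc 0))" using deg[OF x] by simp
    have "D \<le> 1 * (D + 3)" by simp
    also have "\<dots> \<le> l * (D + 3)" using \<open>l \<ge> 3\<close> by (intro mult_le_mono1) simp
    also note D1
    finally have "D \<le> card (layer (Suc 0))" .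
    then show ?case by (simp add: layer0)
  next
    case (Suc i)
    let ?a = "card (layer i)" and ?b = "card (layer (Suc i))" and ?c = "card (layer (Suc (Suc i)))"
    have "D * ?a \<le> ?b" using Suc by simp
    moreover have "1 * ?a \<le> D * ?a" using \<open>D \<ge> 1\<close> by (rule mult_le_mono1)
    ultimately have ab: "?a \<le> ?b" by linarith
    have "l * ((D + 3) * ?b) \<le> card (M i) + card (M (Suc i))"
      using deg_le[of i] by (simp only: mult.assoc)
    also have "\<dots> \<le> l * (?a + ?b) + l * (?b + ?c)"
      using Suc.prems by (intro add_mono M_le) simp_all
    also have "\<dots> = l * (?a + ?b + (?b + ?c))" by (simp only: distrib_left)
    \<comment> \<open>With \<open>?a \<le> ?b\<close> the right side is at most
      \<open>3 * ?b + ?c\<close>; this is the source of the summand \<open>3\<close> in the degree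
      condition.\<close>
    finally have "(D + 3) * ?b \<le> ?a + ?b + (?b + ?c)" using \<open>l \<ge> 3\<close> by simp
    then show ?case using ab by (simp add: distrib_right)
  qed
  have "D ^ i \<le> card (layer i)" if "i \<le> l" for i
    using that
  proof (induction i)
    case (Suc i)
    then have "D * D ^ i \<le> D * card (layer i)" by (intro mult_le_mono2) simp
    also have "\<dots> \<le> card (layer (Suc i))" using growth Suc.prems by simp
    finally show ?case by simp
  qed (simp add: layer0)
  then have "D ^ l \<le> card (layer l)" by simp
  also have "\<dots> \<le> card V" using RV by (intro card_mono assms(1)) (auto simp: layer_def)
  finally show ?thesis .
qed

text \<open>A cut keeps half of the edges and makes the graph bipartite; a subset of large minimum
  degree would then need at least \<open>D ^ l\<close> vertices, more than \<open>V\<close>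
  has.\<close>

lemma even_cycle_bound:
  assumes "finite V" and E: "\<And>e. e \<in> E \<Longrightarrow> card e = 2 \<and> e \<subseteq> V" and D: "card V < D ^ l" and l: "l \<ge> 3"
    and no_cycle: "\<not> (\<exists>ws. length ws = 2 * l \<and> distinct ws \<and> successively (\<lambda>u v. {u, v} \<in> E) ws \<and>
      {last ws, hd ws} \<in> E)"
  shows "card E \<le> 2 * (l * (D + 3)) * card V"
proof (rule ccontr)
  assume contr: "\<not> ?thesis"
  obtain A where A: "card E \<le> 2 * card {e \<in> E. e \<inter> A \<noteq> {} \<and> \<not> e \<subseteq> A}"
    using large_cut[of V E] assms(1) E by blast
  define E' where "E' = {e \<in> E. e \<inter> A \<noteq> {} \<and> \<not> e \<subseteq> A}"
  have "{e \<in> E'. e \<subseteq> V} = E'" using E by (auto simp: E'_def)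
  then have "l * (D + 3) * card V < card {e \<in> E'. e \<subseteq> V}" using A contr by (simp add: E'_def)
  note large = this
  have card2: "card e = 2" if "e \<in> E'" for e using that E by (simp add: E'_def)
  obtain W where W: "W \<subseteq> V" "W \<noteq> {}"
    and deg: "\<forall>v\<in>W. l * (D + 3) < card {u \<in> W. {v, u} \<in> E'}"
    by (rule min_degree_subset[OF assms(1) card2 large])
  define adj where "adj u v \<longleftrightarrow> u \<in> W \<and> v \<in> W \<and> {u, v} \<in> E'" for u v
  have "D \<noteq> 0" using D l by (cases "D = 0") (simp_all add: zero_power)
  obtain x where "x \<in> W" using W(2) by blast
  have "D ^ l \<le> card W"
  proof (rule bipartite_min_degree_bound[of W x adj "\<lambda>u. u \<in> A"])
    show "finite W" using finite_subset[OF W(1) assms(1)] .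
    show "adj v u" if "adj u v" for u v
      using that unfolding adj_def by (simp add: insert_commute)
    show "(u \<in> A) \<noteq> (v \<in> A)" if "adj u v" for u v
      using that unfolding adj_def E'_def by auto
    show "l * (D + 3) \<le> card {u. adj v u}" if "v \<in> W" for v
    proof -
      have "{u. adj v u} = {u \<in> W. {v, u} \<in> E'}" using that by (auto simp: adj_def)
      then show ?thesis using bspec[OF deg that] by simp
    qed
    show "\<not> (\<exists>ws. length ws = 2 * l \<and> distinct ws \<and> successively adj ws \<and> adj (last ws) (hd ws) \<and> set ws \<subseteq> W)"
    proof
      assume "\<exists>ws. length ws = 2 * l \<and> distinct ws \<and> successively adj ws \<and> adj (last ws) (hd ws) \<and> set ws \<subseteq> W"
      then obtain ws where ws: "length ws = 2 * l" "distinct ws" "successively adj ws" "adj (last ws) (hd ws)"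
        by blast
      have "successively (\<lambda>u v. {u, v} \<in> E) ws"
        using ws(3) by (rule successively_mono) (simp add: adj_def E'_def)
      moreover have "{last ws, hd ws} \<in> E" using ws(4) by (simp add: adj_def E'_def)
      ultimately show False using no_cycle ws(1,2) by blast
    qed
  qed (use \<open>x \<in> W\<close> \<open>D \<noteq> 0\<close> l in \<open>simp_all add: adj_def\<close>)
  also have "card W \<le> card V" by (rule card_mono[OF assms(1) W(1)])
  finally show False using D by simp
qed

section \<open>Finite subfields of the algebraic closure of the field with two elements\<close>

text \<open>Over an algebraically closed field \<open>p\<close> splits into linear factors, and a
  repeated factor would make the derivative vanish at its root.\<close>

lemma card_roots_eq_degree:
  fixes p :: "'a :: alg_closed_field poly"
  assumes "p \<noteq> 0" and sep: "\<And>a. poly p a = 0 \<Longrightarrow> poly (pderiv p) a \<noteq> 0"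
  shows "card {x. poly p x = 0} = degree p"
proof -
  obtain A where A: "size A = degree p" "p = smult (lead_coeff p) (\<Prod>x\<in>#A. [:-x, 1:])"
    using alg_closed_imp_factorization[OF assms(1)] by blast
  have roots: "{x. poly p x = 0} = set_mset A"
    using assms(1) by (subst A(2)) (auto simp: poly_prod_mset)
  have "count A a \<le> 1" for a
  proof (rule ccontr)
    assume "\<not> count A a \<le> 1"
    then have "{#a, a#} \<subseteq># A"
      by (simp add: subseteq_mset_def)
    then obtain B where B: "A = {#a, a#} + B"
      by (metis subset_mset.add_diff_inverse)
    define r where "r = smult (lead_coeff p) (\<Prod>x\<in>#B. [:-x, 1:])"
    have "p = [:-a, 1:] * ([:-a, 1:] * r)"
      by (subst A(2)) (simp only: B r_def, simp)
    then have "poly p a = 0" "poly (pderiv p) a = 0"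
      by (simp_all add: pderiv_mult del: mult_pCons_left)
    with sep show False by blast
  qed
  then have "A = mset_set (set_mset A)"
    by (intro multiset_eqI)
      (metis count_mset_set(1,3) finite_set_mset le_antisym not_in_iff One_nat_def Suc_leI count_greater_zero_iff)
  then have "card (set_mset A) = size A"
    by (metis size_mset_set)
  then show ?thesis using roots A(1) by simp
qed

definition subfield_of_order :: "nat \<Rightarrow> 'a::field set \<Rightarrow> bool" where
  "subfield_of_order q K \<longleftrightarrow> finite K \<and> card K = q \<and> 0 \<in> K \<and> 1 \<in> K \<and>
     (\<forall>x\<in>K. \<forall>y\<in>K. x + y \<in> K \<and> x * y \<in> K) \<and> (\<forall>x\<in>K. - x \<in> K)"

lemma two_eq_zero: "(2 :: bit alg_closure) = 0"
proof -
  have "to_ac (2 :: bit) = 0" by simp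
  then show ?thesis by (simp only: to_ac_numeral)
qed

lemma frobenius_add: "(x + y :: bit alg_closure) ^ 2 ^ m = x ^ 2 ^ m + y ^ 2 ^ m"
proof (induction m)
  case (Suc m)
  have "(x + y) ^ 2 ^ Suc m = ((x + y) ^ 2 ^ m) ^ 2"
    by (simp add: power_mult[symmetric] mult.commute)
  also have "\<dots> = (x ^ 2 ^ m) ^ 2 + (y ^ 2 ^ m) ^ 2"
    unfolding Suc.IH by (simp add: power2_sum two_eq_zero)
  finally show ?case by (simp add: power_mult[symmetric] mult.commute)
qed simp

text \<open>\<open>K\<close> is the set of roots of \<open>X ^ q - X\<close>. The derivative is
  \<open>-1\<close> in characteristic two, so there are \<open>q\<close> distinct roots, and
  additivity of the Frobenius map closes them under addition.\<close>

lemma subfield_of_order_exists: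
  assumes "m \<ge> 1"
  shows "\<exists>K :: bit alg_closure set. subfield_of_order (2 ^ m) K"
proof -
  define q where "q = (2::nat) ^ m"
  define K where "K = {x :: bit alg_closure. x ^ q = x}"
  define p :: "bit alg_closure poly" where "p = monom 1 q - monom 1 1"
  have q: "q > 1" using assms unfolding q_def by (intro one_less_power) auto
  have deg: "degree p = q"
    unfolding p_def diff_conv_add_uminus using q
    by (subst degree_add_eq_left) (simp_all add: degree_monom_eq)
  then have p0: "p \<noteq> 0" using q by auto
  have q0: "of_nat q = (0 :: bit alg_closure)"
    using assms by (simp add: q_def two_eq_zero)
  have "pderiv p = - 1"
    unfolding p_def by (simp add: pderiv_diff pderiv_monom q0)
  then have "card {x. poly p x = 0} = degree p"
    by (intro card_roots_eq_degree) (simp_all add: p0)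
  moreover have "{x. poly p x = 0} = K"
    by (auto simp: p_def K_def poly_monom)
  ultimately have card: "card K = q" using deg by simp
  then have fin: "finite K" using q by (metis card.infinite not_less0)
  have minus: "- x = x" for x :: "bit alg_closure"
    using two_eq_zero by (metis add_eq_0_iff2 mult_2 mult_zero_left)
  have "x + y \<in> K" "x * y \<in> K" if "x \<in> K" "y \<in> K" for x y
    using that by (simp_all add: K_def q_def frobenius_add power_mult_distrib)
  then show ?thesis
    using fin card q unfolding subfield_of_order_def
    by (intro exI[of _ K]) (auto simp: minus q_def[symmetric] K_def)
qed

section \<open>A noncommutative group of functionals\<close>

text \<open>The addition is twisted: the first summand moves the argument of the second one by its own
  value at the constant polynomial \<open>1\<close>. This is associative without any linearity assumption.\<close>

typedef (overloaded) ('a::comm_ring_1) functional = "UNIV :: ('a poly \<Rightarrow> 'a) set"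
  morphisms app Functional ..

declare Functional_inverse [simplified, simp]

lemma functional_eqI: "(\<And>f. app v f = app w f) \<Longrightarrow> v = w"
  by (metis app_inject ext)

instantiation functional :: (comm_ring_1) group_add
begin

definition "0 = Functional (\<lambda>_. 0)"
definition "v + w = Functional (\<lambda>f. app v f + app w (f \<circ>\<^sub>p [:app v 1, 1:]))"
definition "- v = Functional (\<lambda>f. - app v (f \<circ>\<^sub>p [:- app v 1, 1:]))"
definition "v - w = v + - (w :: 'a functional)"

lemma app_zero [simp]: "app 0 f = 0"
  by (simp add: zero_functional_def)

lemma app_add: "app (v + w) f = app v f + app w (f \<circ>\<^sub>p [:app v 1, 1:])"
  by (simp add: plus_functional_def)

lemma app_uminus: "app (- v) f = - app v (f \<circ>\<^sub>p [:- app v 1, 1:])"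
  by (simp add: uminus_functional_def)

instance
proof
  fix u v w :: "'a functional"
  have "f \<circ>\<^sub>p [:app u 1, 1:] \<circ>\<^sub>p [:app v 1, 1:] = f \<circ>\<^sub>p [:app u 1 + app v 1, 1:]" for f
    by (simp add: pcompose_assoc[symmetric] pcompose_pCons)
  then show "u + v + w = u + (v + w)"
    by (intro functional_eqI) (simp add: app_add pcompose_1 add.assoc)
  show "- v + v = 0"
    by (intro functional_eqI) (simp add: app_add app_uminus pcompose_1)
qed (auto intro!: functional_eqI simp: app_add minus_functional_def pcompose_1)

end

lemma app_add_1 [simp]: "app (v + w) 1 = app v 1 + app w 1"
  by (simp add: app_add pcompose_1)

lemma app_uminus_1 [simp]: "app (- v) 1 = - app v 1"
  by (simp add: app_uminus pcompose_1)

lemma app_sum_list: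
  "app (sum_list (map v [0..<n])) f =
     (\<Sum>a<n. app (v a) (f \<circ>\<^sub>p [:\<Sum>b<a. app (v b) 1, 1:]))"
proof -
  have one: "app (sum_list (map v [0..<n])) 1 = (\<Sum>b<n. app (v b) 1)" for n
    by (induction n) simp_all
  show ?thesis
    by (induction n) (simp_all add: app_add one)
qed

section \<open>Functionals over a finite field and their number\<close>

text \<open>The values at polynomials of degree at least \<open>l\<close> are junk and set to \<open>0\<close>.\<close>

definition functionals :: "nat \<Rightarrow> 'a::field set \<Rightarrow> 'a functional set" where
  "functionals l K = {v. (\<forall>f. degree f \<ge> l \<longrightarrow> app v f = 0) \<and>
     (\<forall>f g. degree f < l \<longrightarrow> degree g < l \<longrightarrow> app v (f + g) = app v f + app v g) \<and>
     (\<forall>c f. degree f < l \<longrightarrow> app v (smult c f) = c * app v f) \<and>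
     (\<forall>f. (\<forall>i. coeff f i \<in> K) \<longrightarrow> app v f \<in> K)}"

definition eval0 :: "nat \<Rightarrow> 'a::field \<Rightarrow> 'a functional" where
  "eval0 l t = Functional (\<lambda>f. if degree f < l then t * poly f 0 else 0)"

lemma subfield_sum:
  assumes "subfield_of_order q K" "\<And>i. i \<in> A \<Longrightarrow> f i \<in> K"
  shows "sum f A \<in> K"
  using assms(2)
  by (induction A rule: infinite_finite_induct) (use assms(1) in \<open>auto simp: subfield_of_order_def\<close>)

lemma degree_shift: "degree (f \<circ>\<^sub>p [:c, 1::'a::field:]) = degree f"
  by (simp add: degree_pcompose)

text \<open>\<open>functionals l K\<close> requires values in \<open>K\<close> only at polynomials
  over \<open>K\<close>; this lemma keeps the twisted addition inside that set.\<close>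

lemma coeff_shift_in:
  assumes K: "subfield_of_order q K" and "c \<in> K" "\<And>i. coeff f i \<in> K"
  shows "coeff (f \<circ>\<^sub>p [:c, 1:]) i \<in> K"
proof -
  have "\<forall>i. coeff (f \<circ>\<^sub>p [:c, 1:]) i \<in> K" using assms(3)
  proof (induction f)
    case (pCons a f)
    have 1: "coeff f i \<in> K" for i using pCons.prems[of "Suc i"] by simp
    have 2: "a \<in> K" using pCons.prems[of 0] by simp
    note IH = pCons.IH[OF 1]
    have "coeff ([:c, 1:] * g) i \<in> K" if "\<forall>i. coeff g i \<in> K" for g i
      using K assms(2) that by (auto simp: subfield_of_order_def coeff_pCons split: nat.split)
    then show ?case
      using K 2 IH
      by (auto simp: pcompose_pCons subfield_of_order_def coeff_pCons split: nat.split)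
  qed (use K in \<open>simp add: subfield_of_order_def\<close>)
  then show ?thesis by blast
qed

lemma functionals_1_in:
  assumes "subfield_of_order q K" "v \<in> functionals l K"
  shows "app v 1 \<in> K"
  using assms unfolding functionals_def subfield_of_order_def
  by (auto simp: coeff_1)

lemma functionals_add:
  assumes K: "subfield_of_order q K" and v: "v \<in> functionals l K" and w: "w \<in> functionals l K"
  shows "v + w \<in> functionals l K"
  using K v w coeff_shift_in[OF K functionals_1_in[OF K v]]
  unfolding functionals_def mem_Collect_eq app_add
  by (simp add: degree_shift pcompose_add pcompose_smult algebra_simps subfield_of_order_def)

lemma functionals_uminus:
  assumes K: "subfield_of_order q K" and v: "v \<in> functionals l K"
  shows "- v \<in> functionals l K"
proof -
  have "- app v 1 \<in> K"
    using functionals_1_in[OF K v] K by (simp add: subfield_of_order_def)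
  from coeff_shift_in[OF K this] show ?thesis
    using K v unfolding functionals_def mem_Collect_eq app_uminus
    by (simp add: degree_shift pcompose_add pcompose_smult algebra_simps subfield_of_order_def)
qed

lemma functionals_zero:
  assumes "subfield_of_order q K"
  shows "0 \<in> functionals l K"
  using assms by (simp add: functionals_def subfield_of_order_def)

lemma eval0_in_functionals:
  assumes "subfield_of_order q K" "t \<in> K"
  shows "eval0 l t \<in> functionals l K"
  using assms
  by (auto simp: functionals_def eval0_def algebra_simps degree_add_less subfield_of_order_def poly_0_coeff_0)

lemma functionals_expand:
  assumes v: "v \<in> functionals l K" and "degree f < l"
  shows "app v f = (\<Sum>i<l. coeff f i * app v (monom 1 i))"
proof -
  have "f = (\<Sum>i\<le>degree f. smult (coeff f i) (monom 1 i))"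
    by (simp add: smult_monom poly_as_sum_of_monoms)
  also have "\<dots> = (\<Sum>i<l. smult (coeff f i) (monom 1 i))"
    using assms(2) by (intro sum.mono_neutral_left) (auto simp: coeff_eq_0)
  finally have f: "f = (\<Sum>i<l. smult (coeff f i) (monom 1 i))" .
  have "degree (\<Sum>i<m. smult (coeff f i) (monom 1 i)) < l \<and>
      app v (\<Sum>i<m. smult (coeff f i) (monom 1 i)) = (\<Sum>i<m. coeff f i * app v (monom 1 i))"
    if "m \<le> l" for m using that
  proof (induction m)
    case 0
    have "app v (smult 0 0) = 0 * app v 0"
      using v assms(2) unfolding functionals_def mem_Collect_eq by (metis degree_0 gr_implies_not0 not_gr_zero)
    then show ?case using assms(2) by simp
  next
    case (Suc m)
    have d: "degree (monom (1::'a) m) < l" using Suc.prems by (simp add: degree_monom_eq)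
    then have d': "degree (smult (coeff f m) (monom (1::'a) m)) < l"
      using degree_smult_le le_less_trans by blast
    then show ?case using Suc d v unfolding functionals_def mem_Collect_eq
      by (simp add: degree_add_less del: smult_monom smult_eq_0_iff)
  qed
  from this[of l] show ?thesis using f by auto
qed

text \<open>A functional amounts to an arbitrary choice in \<open>K\<close> of its \<open>l\<close>
  values at \<open>1\<close>, \<open>X\<close>, ..., \<open>X ^ (l - 1)\<close>; the inverse map
  extends such a choice linearly.\<close>

lemma card_functionals:
  assumes K: "subfield_of_order q K"
  shows "finite (functionals l K) \<and> card (functionals l K) = q ^ l"
proof -
  have bij: "bij_betw (\<lambda>v. \<lambda>i\<in>{..<l}. app v (monom 1 i)) (functionals l K) ({..<l} \<rightarrow>\<^sub>E K)"
  proof (rule bij_betw_byWitness[where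
        f' = "\<lambda>g. Functional (\<lambda>f. if degree f < l then \<Sum>i<l. coeff f i * g i else 0)"])
    show "\<forall>v\<in>functionals l K. Functional (\<lambda>f. if degree f < l
        then \<Sum>i<l. coeff f i * (\<lambda>i\<in>{..<l}. app v (monom 1 i)) i else 0) = v"
    proof
      fix v assume v: "v \<in> functionals l K"
      then have "app v f = 0" if "degree f \<ge> l" for f
        using that by (simp add: functionals_def)
      then show "Functional (\<lambda>f. if degree f < l
        then \<Sum>i<l. coeff f i * (\<lambda>i\<in>{..<l}. app v (monom 1 i)) i else 0) = v"
        by (intro functional_eqI) (auto simp: functionals_expand[OF v])
    qed
    show "\<forall>g\<in>{..<l} \<rightarrow>\<^sub>E K. (\<lambda>i\<in>{..<l}. app (Functional (\<lambda>f. if degree f < l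
        then \<Sum>i<l. coeff f i * g i else 0)) (monom 1 i)) = g"
      by (auto simp: fun_eq_iff degree_monom_eq if_distrib[of "\<lambda>x. x * _"] PiE_def extensional_def
          cong: if_cong)
    show "(\<lambda>v. \<lambda>i\<in>{..<l}. app v (monom 1 i)) ` functionals l K \<subseteq> {..<l} \<rightarrow>\<^sub>E K"
      using K by (auto simp: functionals_def subfield_of_order_def split: if_splits)
    show "(\<lambda>g. Functional (\<lambda>f. if degree f < l then \<Sum>i<l. coeff f i * g i else 0)) ` ({..<l} \<rightarrow>\<^sub>E K)
        \<subseteq> functionals l K"
    proof -
      have "(\<Sum>i<l. coeff f i * g i) \<in> K" if "g \<in> {..<l} \<rightarrow>\<^sub>E K" "\<forall>i. coeff f i \<in> K" for f g
        using that K by (intro subfield_sum[OF K]) (auto simp: subfield_of_order_def PiE_def Pi_def)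
      then show ?thesis using K
        by (auto simp: functionals_def degree_add_less algebra_simps sum.distrib sum_distrib_left
            subfield_of_order_def)
    qed
  qed
  have "finite K" "card K = q" using K by (simp_all add: subfield_of_order_def)
  then show ?thesis
    using bij bij_betw_finite[OF bij] bij_betw_same_card[OF bij]
    by (simp add: finite_PiE card_PiE)
qed

lemma inj_eval0:
  assumes "l > 0"
  shows "inj (eval0 l)"
proof (rule injI)
  fix s t :: 'a
  assume "eval0 l s = eval0 l t"
  then have "app (eval0 l s) 1 = app (eval0 l t) 1" by simp
  then show "s = t" using assms by (simp add: eval0_def)
qed

section \<open>Alternating relations between evaluations\<close>

text \<open>\<open>- eval0 s + eval0 t\<close> is the multiple \<open>t - s\<close> of the evaluation at \<open>- s\<close>; in a sum of such
  terms, the preceding terms shift the point of evaluation.\<close>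

lemma sum_list_eval0_differences:
  assumes "degree f < l"
  shows "app (sum_list (map (\<lambda>a. - eval0 l (s a) + eval0 l (t a)) [0..<n])) f =
    (\<Sum>a<n. (t a - s a) * poly f ((\<Sum>b<a. t b - s b) - s a))"
  using assms
  by (auto simp: app_sum_list app_add app_uminus eval0_def degree_shift poly_pcompose algebra_simps pcompose_1
      intro!: sum.cong)

text \<open>\<open>x 0, y 0, x 1, y 1, ...\<close> will be the sums along the \<open>2 * l\<close>
  consecutive edges of a cycle, where edges that follow each other have different sums.\<close>

definition alternating_free :: "nat \<Rightarrow> 'a::group_add set \<Rightarrow> bool" where
  "alternating_free l A \<longleftrightarrow> (\<forall>x y.
     (\<forall>a<l. x a \<in> A \<and> y a \<in> A \<and> x a \<noteq> y a \<and> y a \<noteq> x (Suc a mod l)) \<longrightarrow>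
     sum_list (map (\<lambda>a. - x a + y a) [0..<l]) \<noteq> 0)"

text \<open>If \<open>c a\<close> differed from all other nodes, the product of the linear factors
  at those nodes, of degree less than \<open>l\<close>, would isolate the term of
  \<open>a\<close>.\<close>

lemma repeated_node:
  fixes \<delta> c :: "nat \<Rightarrow> 'a::field"
  assumes zero: "\<And>f. degree f < l \<Longrightarrow> (\<Sum>a<l. \<delta> a * poly f (c a)) = 0"
    and "a < l" "\<delta> a \<noteq> 0"
  shows "\<exists>b<l. b \<noteq> a \<and> c b = c a"
proof (rule ccontr)
  assume no: "\<not> ?thesis"
  define f where "f = (\<Prod>b\<in>{..<l} - {a}. [:- c b, 1:])"
  have "degree f = (\<Sum>b\<in>{..<l} - {a}. degree [:- c b, 1:])"
    unfolding f_def by (intro degree_prod_eq_sum_degree) auto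
  also have "\<dots> < l" using assms(2) by simp
  finally have "(\<Sum>b<l. \<delta> b * poly f (c b)) = 0" by (rule zero)
  moreover have "poly f (c b) = 0" if "b < l" "b \<noteq> a" for b
    using that by (auto simp: f_def poly_prod)
  ultimately have "\<delta> a * poly f (c a) = 0"
    using assms(2) by (simp add: sum.remove[of "{..<l}" a])
  moreover have "poly f (c a) \<noteq> 0"
    using no by (auto simp: f_def poly_prod)
  ultimately show False using assms(3) by simp
qed

text \<open>A relation makes every node \<open>c a\<close> occur at least twice, while cyclically
  consecutive nodes differ. Three such nodes are pairwise different; for five, each class of equal
  nodes is independent in the 5-cycle and so has exactly two elements, but five is odd.\<close>

lemma alternating_free_eval0:
  fixes K :: "'a::field set"
  assumes "l \<in> {3, 5}"
  shows "alternating_free l (eval0 l ` K)"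
  unfolding alternating_free_def
proof (intro allI impI notI)
  fix x y :: "nat \<Rightarrow> 'a functional"
  assume xy: "\<forall>a<l. x a \<in> eval0 l ` K \<and> y a \<in> eval0 l ` K \<and> x a \<noteq> y a \<and> y a \<noteq> x (Suc a mod l)"
    and zero: "sum_list (map (\<lambda>a. - x a + y a) [0..<l]) = 0"
  have "\<forall>a. \<exists>s t. a < l \<longrightarrow> x a = eval0 l s \<and> y a = eval0 l t" using xy by blast
  then obtain s t where st: "\<And>a. a < l \<Longrightarrow> x a = eval0 l (s a) \<and> y a = eval0 l (t a)"
    by metis
  have st': "s a \<noteq> t a" "t a \<noteq> s (Suc a mod l)" if "a < l" for a
    using xy that st[of a] st[of "Suc a mod l"] by auto
  have "map (\<lambda>a. - x a + y a) [0..<l] = map (\<lambda>a. - eval0 l (s a) + eval0 l (t a)) [0..<l]"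
    using st by simp
  with zero have zero': "sum_list (map (\<lambda>a. - eval0 l (s a) + eval0 l (t a)) [0..<l]) = 0"
    by simp
  define \<delta> where "\<delta> a = t a - s a" for a
  define c where "c a = (\<Sum>b<a. \<delta> b) - s a" for a
  have sum0: "(\<Sum>a<l. \<delta> a * poly f (c a)) = 0" if "degree f < l" for f
    using sum_list_eval0_differences[OF that, of s t l] zero' by (simp add: \<delta>_def c_def)
  have \<delta>: "\<delta> a \<noteq> 0" if "a < l" for a using st'[OF that] by (simp add: \<delta>_def)
  note rep = repeated_node[OF sum0 _ \<delta>]
  \<comment> \<open>\<open>c (Suc a) - c a = t a - s (Suc a)\<close>.\<close>
  have step: "c a \<noteq> c (Suc a)" if "Suc a < l" for a
    using st'(2)[of a] that by (auto simp: c_def \<delta>_def)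
  \<comment> \<open>The polynomial \<open>1\<close> shows that the differences sum to zero, so the
    last node is \<open>- t (l - 1)\<close> and differs from the first one,
    \<open>- s 0\<close>.\<close>
  have "(\<Sum>a<l. \<delta> a) = 0" using sum0[of 1] assms by auto
  moreover have "c (l - 1) + \<delta> (l - 1) + s (l - 1) = (\<Sum>a<l. \<delta> a)"
    using assms by (cases l) (auto simp: c_def)
  ultimately have "c (l - 1) + t (l - 1) = 0" by (simp add: \<delta>_def)
  moreover have "t (l - 1) \<noteq> s 0" using st'(2)[of "l - 1"] assms by auto
  moreover have "c 0 = - s 0" by (simp add: c_def)
  ultimately have last: "c (l - 1) \<noteq> c 0"
    by (metis add_eq_0_iff minus_equation_iff add.commute)
  from assms consider "l = 3" | "l = 5" by blast
  then show False
  proof cases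
    case 1
    have "c 0 \<noteq> c 1" "c 2 \<noteq> c 0"
      using step[of 0] last 1 by (simp_all add: eval_nat_numeral)
    then show False
      using rep[of 0] 1 by (auto simp: less_Suc_eq eval_nat_numeral)
  next
    case 2
    have neq: "c 0 \<noteq> c 1" "c 1 \<noteq> c 2" "c 2 \<noteq> c 3" "c 3 \<noteq> c 4" "c 4 \<noteq> c 0"
      using step[of 0] step[of 1] step[of 2] step[of 3] last 2 by (simp_all add: eval_nat_numeral)
    have "(\<exists>b<5. Q b) \<longleftrightarrow> Q 0 \<or> Q 1 \<or> Q 2 \<or> Q 3 \<or> Q (4::nat)" for Q
      by (auto simp: less_Suc_eq eval_nat_numeral)
    note rep[unfolded 2 this]
    from this[of 0] this[of 1] this[of 2] this[of 3] this[of 4] show False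
      using neq by simp metis
  qed
qed

section \<open>Suspended cycles and transversals\<close>

definition suspended_cycle :: "nat \<Rightarrow> nat \<Rightarrow> 'a set set \<Rightarrow> bool" where
  "suspended_cycle k m E \<longleftrightarrow> (\<exists>S v. finite S \<and> card S = k - 2 \<and> inj_on v {..<m} \<and>
     S \<inter> v ` {..<m} = {} \<and> (\<forall>i<m. S \<union> {v i, v (Suc i mod m)} \<in> E))"

lemma is_free_suspension_cycle_iff:
  assumes G: "hypergraph G" and m: "m > 0"
  shows "is_free (suspension k (cycle m)) G \<longleftrightarrow> \<not> suspended_cycle k m (edges G)"
proof -
  let ?H = "suspension k (cycle m)"
  have H: "verts ?H = Inr ` {..<k - 2} \<union> Inl ` {..<m}"
    "edges ?H = {Inr ` {..<k - 2} \<union> Inl ` {i, Suc i mod m} | i. i < m}"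
    unfolding suspension_def cycle_def Let_def fst_conv snd_conv by blast+
  have img: "f ` (Inr ` {..<k - 2} \<union> Inl ` {i, Suc i mod m}) =
      (f \<circ> Inr) ` {..<k - 2} \<union> {f (Inl i), f (Inl (Suc i mod m))}" for f :: "nat + nat \<Rightarrow> 'b" and i
    by (auto simp: image_Un image_comp)
  have "suspended_cycle k m (edges G)" if "\<not> is_free ?H G"
  proof -
    from that obtain G' f where G': "subhypergraph G' G" "bij_betw f (verts ?H) (verts G')"
      "edges G' = (\<lambda>e. f ` e) ` edges ?H"
      by (auto simp: is_free_def isomorphic_def)
    define S where "S = (f \<circ> Inr) ` {..<k - 2}"
    have inj: "inj_on f (verts ?H)" using G'(2) by (rule bij_betw_imp_inj_on)
    have "inj_on (f \<circ> Inr) {..<k - 2}" "inj_on (f \<circ> Inl) {..<m}"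
      using inj unfolding H by (auto simp: inj_on_def)
    moreover have "S \<inter> (f \<circ> Inl) ` {..<m} = {}"
      using inj unfolding H S_def by (auto simp: inj_on_def)
    moreover have "S \<union> {(f \<circ> Inl) i, (f \<circ> Inl) (Suc i mod m)} \<in> edges G" if "i < m" for i
    proof -
      have "f ` (Inr ` {..<k - 2} \<union> Inl ` {i, Suc i mod m}) \<in> edges G'"
        unfolding G'(3) H using that by blast
      then show ?thesis
        using G'(1) unfolding img subhypergraph_def S_def by auto
    qed
    moreover have "card S = k - 2"
      unfolding S_def using calculation(1) by (simp add: card_image del: o_apply)
    ultimately show ?thesis
      unfolding suspended_cycle_def
      by (intro exI[of _ S] exI[of _ "f \<circ> Inl"]) (simp add: S_def)
  qed
  moreover have "\<not> is_free ?H G" if "suspended_cycle k m (edges G)"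
  proof -
    from that obtain S v where S: "finite S" "card S = k - 2" "inj_on v {..<m}" "S \<inter> v ` {..<m} = {}"
      and E: "\<And>i. i < m \<Longrightarrow> S \<union> {v i, v (Suc i mod m)} \<in> edges G"
      unfolding suspended_cycle_def by blast
    obtain h where h: "bij_betw h {..<k - 2} S"
      using ex_bij_betw_nat_finite[OF S(1)] S(2) by (auto simp: atLeast0LessThan)
    define f where "f = case_sum v h"
    have "h j \<noteq> v i \<and> v i \<noteq> h j" if "j < k - 2" "i < m" for i j
      using S(4) h that unfolding bij_betw_def by blast
    then have inj: "inj_on f (verts ?H)"
      using S(3) h unfolding H f_def bij_betw_def inj_on_def by auto
    have f: "f ` (Inr ` {..<k - 2} \<union> Inl ` {i, Suc i mod m}) = S \<union> {v i, v (Suc i mod m)}" for i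
      unfolding img using h by (auto simp: f_def bij_betw_def o_def)
    define G' where "G' = (f ` verts ?H, (\<lambda>e. f ` e) ` edges ?H)"
    have edges: "edges G' \<subseteq> edges G" using E f by (auto simp: G'_def H)
    have verts: "verts G' = S \<union> v ` {..<m}"
      using h by (auto simp: G'_def H f_def image_Un image_image bij_betw_def)
    have "v i \<in> verts G" if "i < m" for i
      using E[OF that] G by (auto simp: hypergraph_def)
    moreover have "S \<subseteq> verts G"
      using E[OF m] G by (auto simp: hypergraph_def)
    ultimately have "verts G' \<subseteq> verts G" using verts by auto
    moreover have "hypergraph G'"
    proof -
      have "e \<subseteq> verts ?H" if "e \<in> edges ?H" for e
        using that m unfolding H by auto
      then have "\<forall>e\<in>edges G'. e \<subseteq> verts G'" by (auto simp: G'_def)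
      then show ?thesis using S(1) by (simp add: hypergraph_def verts)
    qed
    ultimately have "subhypergraph G' G"
      using edges by (simp add: subhypergraph_def)
    moreover have "isomorphic ?H G'"
      unfolding isomorphic_def
      by (intro exI[of _ f]) (simp add: G'_def inj inj_on_imp_bij_betw)
    ultimately show ?thesis unfolding is_free_def not_not by (intro exI conjI)
  qed
  ultimately show ?thesis by blast
qed

text \<open>Pulls a copy back along the inverse of \<open>h\<close>; this allows moving the
  construction onto natural numbers.\<close>

lemma suspended_cycle_image:
  assumes "suspended_cycle k m ((`) h ` E)" "inj_on h (\<Union>E)" "m > 0"
  shows "suspended_cycle k m E"
proof -
  obtain S v where S: "finite S" "card S = k - 2" "inj_on v {..<m}" "S \<inter> v ` {..<m} = {}"
    and E: "\<And>i. i < m \<Longrightarrow> S \<union> {v i, v (Suc i mod m)} \<in> (`) h ` E"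
    using assms(1) unfolding suspended_cycle_def by blast
  define g where "g = inv_into (\<Union>E) h"
  have inj: "inj_on g (h ` \<Union>E)"
    unfolding g_def by (rule inj_on_inv_into) simp
  have g: "g ` h ` e = e" if "e \<in> E" for e
    unfolding g_def using assms(2) that by (simp add: Union_upper)
  have sub: "S \<subseteq> h ` \<Union>E" "v ` {..<m} \<subseteq> h ` \<Union>E"
    using E assms(3) by blast+
  have "g ` S \<union> {g (v i), g (v (Suc i mod m))} \<in> E" if i: "i < m" for i
  proof -
    obtain e where e: "e \<in> E" "S \<union> {v i, v (Suc i mod m)} = h ` e" using E[OF i] by auto
    have "g ` S \<union> {g (v i), g (v (Suc i mod m))} = g ` (S \<union> {v i, v (Suc i mod m)})" by auto
    also have "\<dots> = e" unfolding e(2) using g[OF e(1)] .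
    finally show ?thesis using e(1) by simp
  qed
  moreover have "g ` S \<inter> (g \<circ> v) ` {..<m} = g ` (S \<inter> v ` {..<m})"
    using inj_on_image_Int[OF inj sub] by (simp add: image_comp)
  moreover have "card (g ` S) = card S" "inj_on (g \<circ> v) {..<m}"
    using inj sub S(3) by (auto intro: card_image inj_on_subset comp_inj_on)
  ultimately show ?thesis
    using S unfolding suspended_cycle_def
    by (intro exI[of _ "g ` S"] exI[of _ "g \<circ> v"]) auto
qed

text \<open>The tag \<open>i\<close> makes the \<open>k\<close> copies of the group disjoint; the
  order of summation matters, as the group need not be commutative.\<close>

definition transversals :: "nat \<Rightarrow> 'g set \<Rightarrow> 'g::group_add set \<Rightarrow> (nat \<times> 'g) set set" where
  "transversals k \<Gamma> A = {(\<lambda>i. (i, g i)) ` {..<k} | g.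
     (\<forall>i<k. g i \<in> \<Gamma>) \<and> sum_list (map g [0..<k]) \<in> A}"

text \<open>The first \<open>n\<close> entries and the total in \<open>A\<close> can be chosen
  freely; they determine the last entry.\<close>

lemma card_transversals_ge:
  fixes \<Gamma> :: "'g::group_add set"
  assumes \<Gamma>: "finite \<Gamma>" "0 \<in> \<Gamma>" "\<And>x y. x \<in> \<Gamma> \<Longrightarrow> y \<in> \<Gamma> \<Longrightarrow> x + y \<in> \<Gamma>" "\<And>x. x \<in> \<Gamma> \<Longrightarrow> - x \<in> \<Gamma>"
    and A: "A \<subseteq> \<Gamma>"
  shows "card \<Gamma> ^ n * card A \<le> card (transversals (Suc n) \<Gamma> A)"
proof -
  let ?D = "({..<n} \<rightarrow>\<^sub>E \<Gamma>) \<times> A"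
  define F :: "(nat \<Rightarrow> 'g) \<times> 'g \<Rightarrow> nat \<Rightarrow> 'g" where "F = (\<lambda>(g, a). g(n := - sum_list (map g [0..<n]) + a))"
  define \<Phi> where "\<Phi> p = (\<lambda>i. (i, F p i)) ` {..<Suc n}" for p
  have sum: "sum_list (map g [0..<m]) \<in> \<Gamma>" if "\<forall>i<m. g i \<in> \<Gamma>" for g m
    using that by (induction m) (simp_all add: \<Gamma>)
  have sumF: "sum_list (map (F (g, a)) [0..<Suc n]) = a" for g a
  proof -
    have "map (F (g, a)) [0..<n] = map g [0..<n]" by (simp add: F_def)
    then have "sum_list (map (F (g, a)) [0..<Suc n]) = sum_list (map g [0..<n]) + F (g, a) n"
      by (simp del: map_eq_conv)
    then show ?thesis by (simp add: F_def del: upt_Suc)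
  qed
  have "inj_on \<Phi> ?D"
  proof (rule inj_onI)
    fix p p' assume pp: "p \<in> ?D" "p' \<in> ?D" "\<Phi> p = \<Phi> p'"
    obtain g a g' a' where p: "p = (g, a)" "p' = (g', a')" by fastforce
    have F: "F p i = F p' i" if "i < Suc n" for i
    proof -
      have "(i, F p i) \<in> \<Phi> p'" using that pp(3) unfolding \<Phi>_def by blast
      then show ?thesis by (auto simp: \<Phi>_def)
    qed
    have "g i = g' i" if "i < n" for i
      using F[of i] that by (simp add: p F_def)
    then have "g = g'"
      using pp(1,2) by (intro PiE_ext[of g "{..<n}" "\<lambda>_. \<Gamma>" g']) (auto simp: p)
    have "map (F (g, a)) [0..<Suc n] = map (F (g', a')) [0..<Suc n]"
    proof (rule map_cong[OF refl])
      fix i assume "i \<in> set [0..<Suc n]"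
      then have "i < Suc n" by auto
      then show "F (g, a) i = F (g', a') i" using F unfolding p by blast
    qed
    then have "sum_list (map (F (g, a)) [0..<Suc n]) = sum_list (map (F (g', a')) [0..<Suc n])"
      by (rule arg_cong)
    then have "a = a'" unfolding sumF .
    with \<open>g = g'\<close> show "p = p'" by (simp add: p)
  qed
  moreover have "\<Phi> ` ?D \<subseteq> transversals (Suc n) \<Gamma> A"
  proof safe
    fix g a assume g: "g \<in> {..<n} \<rightarrow>\<^sub>E \<Gamma>" and a: "a \<in> A"
    have "sum_list (map g [0..<n]) \<in> \<Gamma>" using g by (intro sum) auto
    moreover have "a \<in> \<Gamma>" using a A by blast
    ultimately have "- sum_list (map g [0..<n]) + a \<in> \<Gamma>" by (intro \<Gamma>(3,4))
    then have "F (g, a) i \<in> \<Gamma>" if "i < Suc n" for i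
      using that PiE_mem[OF g, of i] by (cases "i = n") (simp_all add: F_def)
    then show "\<Phi> (g, a) \<in> transversals (Suc n) \<Gamma> A"
      unfolding transversals_def \<Phi>_def using a
      by (intro CollectI exI[of _ "F (g, a)"] conjI allI impI refl) (simp_all only: sumF)
  qed
  moreover have "finite (transversals (Suc n) \<Gamma> A)"
    by (rule finite_subset[of _ "Pow ({..<Suc n} \<times> \<Gamma>)"]) (auto simp: transversals_def \<Gamma>(1))
  ultimately have "card ?D \<le> card (transversals (Suc n) \<Gamma> A)"
    by (rule card_inj_on_le)
  moreover have "card ?D = card \<Gamma> ^ n * card A"
    unfolding card_cartesian_product by (subst card_PiE) simp_all
  ultimately show ?thesis by simp
qed

text \<open>Negation reverses sums, so the common left part \<open>u a\<close>, which may vary with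
  \<open>a\<close>, cancels within each pair; the fixed right part \<open>t\<close> stays and lets
  neighbouring pairs cancel.\<close>

lemma sum_list_alternating_telescope:
  fixes z :: "nat \<Rightarrow> 'g::group_add"
  shows "sum_list (map (\<lambda>a. - (u a + z a + t) + (u a + z (Suc a) + t)) [0..<n]) = - (z 0 + t) + (z n + t)"
proof (induction n)
  case (Suc n)
  have "- (u n + z n + t) + (u n + z (Suc n) + t) = - (z n + t) + (z (Suc n) + t)"
    by (simp add: minus_add add.assoc diff_conv_add_uminus del: add_uminus_conv_diff)
  with Suc show ?case
    by (simp add: minus_add add.assoc diff_conv_add_uminus del: add_uminus_conv_diff)
qed simp

lemma sum_list_two_changes:
  fixes g :: "nat \<Rightarrow> 'g::group_add"
  assumes "p < q" "q < k"
  shows "sum_list (map g [0..<k]) = sum_list (map g [0..<p]) + g p + sum_list (map g [Suc p..<q])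
     + g q + sum_list (map g [Suc q..<k])"
proof -
  have "[i..<n] = [i..<j] @ [j..<n]" if "i \<le> j" "j \<le> n" for i j n :: nat
    using that by (metis upt_add_eq_append le_add_diff_inverse)
  from this[of 0 p k] this[of "Suc p" q k]
  have "[0..<k] = [0..<p] @ [p] @ [Suc p..<q] @ [q] @ [Suc q..<k]"
    using assms by (simp add: upt_conv_Cons)
  then show ?thesis by (simp add: add.assoc)
qed

text \<open>The core \<open>S\<close> occupies all but two coordinates \<open>p < q\<close>, and the
  cycle alternates between these. Two edges sharing their vertex in coordinate \<open>p\<close> have
  sums differing only in the \<open>q\<close>-summand, so the alternating sum telescopes to zero
  around the cycle, against \<open>alternating_free\<close>.\<close>

lemma transversals_no_suspended_cycle:
  assumes A: "alternating_free l A" and "l \<ge> 2" "k \<ge> 2"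
  shows "\<not> suspended_cycle k (2 * l) (transversals k \<Gamma> A)"
proof
  assume "suspended_cycle k (2 * l) (transversals k \<Gamma> A)"
  then obtain S v where S: "finite S" "card S = k - 2" "inj_on v {..<2 * l}" "S \<inter> v ` {..<2 * l} = {}"
    and E: "\<And>i. i < 2 * l \<Longrightarrow> S \<union> {v i, v (Suc i mod (2 * l))} \<in> transversals k \<Gamma> A"
    unfolding suspended_cycle_def by blast
  define V where "V j = v (j mod (2 * l))" for j
  have V_eq: "V i = V j \<longleftrightarrow> i mod (2 * l) = j mod (2 * l)" for i j
    using S(3) assms(2) unfolding V_def by (auto simp: inj_on_def)
  have V_S: "V j \<notin> S" for j
    using S(4) assms(2) unfolding V_def by auto
  have "\<exists>g. S \<union> {V j, V (Suc j)} = (\<lambda>i. (i, g i)) ` {..<k} \<and> sum_list (map g [0..<k]) \<in> A" for j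
    using E[of "j mod (2 * l)"] assms(2) unfolding transversals_def V_def by (auto simp: mod_Suc_eq)
  then obtain g where g: "\<And>j. S \<union> {V j, V (Suc j)} = (\<lambda>i. (i, g j i)) ` {..<k}"
    and gA: "\<And>j. sum_list (map (g j) [0..<k]) \<in> A"
    by metis
  have mem: "fst x < k \<and> g j (fst x) = snd x" if "x \<in> S \<or> x = V j \<or> x = V (Suc j)" for x j
  proof -
    have "x \<in> (\<lambda>i. (i, g j i)) ` {..<k}" using that g[of j] by blast
    then show ?thesis by auto
  qed
  define R where "R = {..<k} - fst ` S"
  have "inj_on fst S"
    by (rule inj_onI) (metis mem prod.expand)
  then have "card (fst ` S) = k - 2" using S(2) by (simp add: card_image)
  moreover have "fst ` S \<subseteq> {..<k}" using mem by auto
  ultimately have "card R = 2"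
    unfolding R_def using assms(3) by (simp add: card_Diff_subset S(1))
  then obtain p q where "R = {p, q}" "p \<noteq> q" by (auto simp: card_2_iff)
  then obtain p q where R: "R = {p, q}" "p < q"
    by (metis insert_commute linorder_neqE_nat)
  then have "q < k" unfolding R_def by blast
  have fst_V: "fst (V j) \<in> {p, q}" for j
  proof -
    have "fst (V j) \<notin> fst ` S"
    proof
      assume "fst (V j) \<in> fst ` S"
      then obtain x where x: "x \<in> S" "fst x = fst (V j)" by auto
      then have "x = V j" using mem[of x j] mem[of "V j" j] by (simp add: prod_eq_iff)
      with x V_S show False by blast
    qed
    then show ?thesis using mem[of "V j" j] R by (auto simp: R_def)
  qed
  have fst_neq: "fst (V j) \<noteq> fst (V (Suc j))" for j
  proof
    assume "fst (V j) = fst (V (Suc j))"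
    then have "V j = V (Suc j)" using mem[of "V j" j] mem[of "V (Suc j)" j] by (simp add: prod_eq_iff)
    then have "j mod (2 * l) = Suc j mod (2 * l)" by (simp add: V_eq)
    then show False using assms(2) by (simp add: mod_Suc split: if_splits)
  qed
  \<comment> \<open>The start is rotated so that even positions lie in coordinate \<open>q\<close>;
    the entries at \<open>p\<close> then belong to the left part that cancels.\<close>
  obtain e where e: "fst (V e) = q" using fst_V[of 0] fst_V[of 1] fst_neq[of 0] by auto
  define W where "W j = V (j + e)" for j
  have fst_W: "fst (W (2 * a)) = q \<and> fst (W (Suc (2 * a))) = p" for a
  proof (induction a)
    case 0
    show ?case using e fst_V[of "Suc e"] fst_neq[of e] by (auto simp: W_def)
  next
    case (Suc a)
    have "fst (W (2 * Suc a)) = q"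
      using Suc fst_V[of "Suc (Suc (2 * a + e))"] fst_neq[of "Suc (2 * a + e)"] by (auto simp: W_def)
    then show ?case
      using fst_V[of "Suc (2 * Suc a + e)"] fst_neq[of "2 * Suc a + e"] by (auto simp: W_def)
  qed
  \<comment> \<open>Vertices two apart share their coordinate and are distinct because
    \<open>2 * l\<close> does not divide \<open>2\<close>, so their group elements differ.\<close>
  have W_neq: "snd (W j) \<noteq> snd (W (Suc (Suc j)))" for j
  proof
    assume "snd (W j) = snd (W (Suc (Suc j)))"
    moreover have "fst (W j) = fst (W (Suc (Suc j)))"
      using fst_W[of "j div 2"] fst_W[of "Suc (j div 2)"] by (cases "even j") (auto elim!: evenE oddE)
    ultimately have "W j = W (Suc (Suc j))" by (simp add: prod_eq_iff)
    then have "(j + e) mod (2 * l) = (j + e + 2) mod (2 * l)" by (simp add: W_def V_eq)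
    then have "2 * l dvd 2"
      using mod_eq_dvd_iff_nat[of "j + e" "j + e + 2" "2 * l"] by simp
    then show False using assms(2) by (auto dest: dvd_imp_le)
  qed
  have W_per: "W (2 * (a mod l)) = W (2 * a)" "W (Suc (2 * (a mod l))) = W (Suc (2 * a))" for a
  proof -
    have "(2 * (a mod l) + c) mod (2 * l) = (2 * a + c) mod (2 * l)" for c
      by (metis mod_add_left_eq mod_mult_mult1 mod_mod_trivial)
    from this[of e] this[of "Suc e"] show "W (2 * (a mod l)) = W (2 * a)"
      "W (Suc (2 * (a mod l))) = W (Suc (2 * a))" by (simp_all add: W_def V_eq)
  qed
  have g_S: "g j i = g 0 i" if "i < k" "i \<noteq> p" "i \<noteq> q" for i j
  proof -
    have "i \<in> fst ` S" using that R by (auto simp: R_def)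
    then show ?thesis using mem by fastforce
  qed
  define L M N where "L = sum_list (map (g 0) [0..<p])" and "M = sum_list (map (g 0) [Suc p..<q])"
    and "N = sum_list (map (g 0) [Suc q..<k])"
  have sum_g: "sum_list (map (g j) [0..<k]) = L + g j p + M + g j q + N" for j
  proof -
    have "map (g j) [0..<p] = map (g 0) [0..<p]" "map (g j) [Suc p..<q] = map (g 0) [Suc p..<q]"
      "map (g j) [Suc q..<k] = map (g 0) [Suc q..<k]"
      using R(2) \<open>q < k\<close> by (auto intro!: g_S)
    then show ?thesis
      unfolding sum_list_two_changes[OF R(2) \<open>q < k\<close>, of "g j"] L_def M_def N_def by metis
  qed
  define u where "u a = L + snd (W (Suc (2 * a))) + M" for a
  define x where "x a = u a + snd (W (2 * a)) + N" for a
  define y where "y a = u a + snd (W (2 * Suc a)) + N" for a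
  have "x a \<in> A" for a
    using gA[of "2 * a + e"] mem[of "W (2 * a)" "2 * a + e"] mem[of "W (Suc (2 * a))" "2 * a + e"] fst_W[of a]
    by (simp add: sum_g x_def u_def) (simp add: W_def)
  moreover have "y a \<in> A" for a
    using gA[of "Suc (2 * a + e)"] mem[of "W (Suc (2 * a))" "Suc (2 * a + e)"]
      mem[of "W (2 * Suc a)" "Suc (2 * a + e)"] fst_W[of a] fst_W[of "Suc a"]
    by (simp add: sum_g y_def u_def) (simp add: W_def)
  moreover have "x a \<noteq> y a" for a
    using W_neq[of "2 * a"] by (simp add: x_def y_def)
  moreover have "y a \<noteq> x (Suc a mod l)" for a
    using W_neq[of "Suc (2 * a)"] W_per[of "Suc a"] by (simp add: x_def y_def u_def)
  ultimately have "sum_list (map (\<lambda>a. - x a + y a) [0..<l]) \<noteq> 0"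
    using A unfolding alternating_free_def by blast
  moreover have "(\<lambda>a. - x a + y a) = (\<lambda>a. - (u a + snd (W (2 * a)) + N) + (u a + snd (W (2 * Suc a)) + N))"
    by (simp add: x_def y_def fun_eq_iff)
  moreover have "W (2 * l) = W 0" using W_per(1)[of l] by simp
  ultimately show False
    using sum_list_alternating_telescope[of u "\<lambda>a. snd (W (2 * a))" N l] by simp
qed

section \<open>The lower bound\<close>

lemma finite_edge_numbers:
  "finite {card (edges G) | G :: nat hypergraph. uniform_hypergraph k G \<and> card (verts G) = n \<and> is_free H G}"
proof (rule finite_subset)
  show "{card (edges G) | G :: nat hypergraph. uniform_hypergraph k G \<and> card (verts G) = n \<and> is_free H G}
    \<subseteq> {..2 ^ n}"
  proof clarsimp
    fix V :: "nat set" and E assume "uniform_hypergraph k (V, E)"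
    then have "finite V" "E \<subseteq> Pow V" by (auto simp: uniform_hypergraph_def hypergraph_def)
    then show "card E \<le> 2 ^ card V" using card_mono[of "Pow V" E] by (simp add: card_Pow)
  qed
qed simp

text \<open>The edges are transported into \<open>{..<n}\<close> by an injection; vertices outside
  its image stay isolated.\<close>

lemma ex_num_suspension_cycle_ge:
  assumes U: "finite U" "card U \<le> n" and E: "\<And>e. e \<in> E \<Longrightarrow> e \<subseteq> U \<and> card e = k"
    and free: "\<not> suspended_cycle k m E" and m: "m > 0"
  shows "card E \<le> ex_num k n (suspension k (cycle m))"
proof -
  obtain h where h: "inj_on h U" "h ` U \<subseteq> {..<n}"
    using U card_le_inj[of U "{..<n}"] by auto
  define G where "G = ({..<n}, (`) h ` E)"
  have inj: "inj_on ((`) h) E"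
    using E h(1) by (intro inj_onI) (metis inj_on_image_eq_iff)
  have "card (h ` e) = k" if "e \<in> E" for e
    using E[OF that] h(1) by (metis card_image inj_on_subset)
  moreover have "h ` e \<subseteq> {..<n}" if "e \<in> E" for e
    using E[OF that] h(2) by blast
  ultimately have unif: "uniform_hypergraph k G"
    by (auto simp: uniform_hypergraph_def hypergraph_def G_def)
  have "inj_on h (\<Union>E)" using h(1) E by (meson Sup_least inj_on_subset)
  then have "\<not> suspended_cycle k m (edges G)"
    using free suspended_cycle_image m by (fastforce simp: G_def)
  then have "is_free (suspension k (cycle m)) G"
    using is_free_suspension_cycle_iff[OF _ m, of G k] unif unfolding uniform_hypergraph_def by blast
  then have "card (edges G) \<in> {card (edges G) | G :: nat hypergraph. uniform_hypergraph k G \<and>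
      card (verts G) = n \<and> is_free (suspension k (cycle m)) G}"
    using unif by (intro CollectI exI[of _ G]) (simp add: G_def)
  then have "card (edges G) \<le> ex_num k n (suspension k (cycle m))"
    unfolding ex_num_def by (rule Max_ge[OF finite_edge_numbers])
  then show ?thesis by (simp add: G_def card_image[OF inj])
qed

text \<open>The group has order \<open>q ^ l\<close>, so its \<open>k\<close> copies need
  \<open>k * q ^ l\<close> vertices; there are \<open>q ^ l\<close> choices for each of
  \<open>k - 1\<close> entries and \<open>q\<close> for the total.\<close>

lemma ex_num_lower_bound:
  assumes l: "l \<in> {3, 5}" and "k \<ge> 2" "m \<ge> 1" and q: "q = 2 ^ m" and n: "k * q ^ l \<le> n"
  shows "q ^ (l * (k - 1) + 1) \<le> ex_num k n (suspension k (cycle (2 * l)))"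
proof -
  obtain K :: "bit alg_closure set" where K: "subfield_of_order q K"
    using subfield_of_order_exists assms by blast
  let ?\<Gamma> = "functionals l K" and ?A = "eval0 l ` K"
  have l0: "l > 0" "l \<ge> 2" using l by auto
  have \<Gamma>: "finite ?\<Gamma>" "card ?\<Gamma> = q ^ l" using card_functionals[OF K] by auto
  have A: "?A \<subseteq> ?\<Gamma>" using eval0_in_functionals[OF K] by blast
  have "card ?A = card K"
    by (rule card_image[OF inj_on_subset[OF inj_eval0[OF l0(1)]]]) simp
  then have "card ?A = q" using K by (simp add: subfield_of_order_def)
  then have "q ^ (l * (k - 1) + 1) = card ?\<Gamma> ^ (k - 1) * card ?A"
    by (simp add: \<Gamma> power_mult mult.commute)
  also have "\<dots> \<le> card (transversals (Suc (k - 1)) ?\<Gamma> ?A)"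
    by (intro card_transversals_ge \<Gamma> functionals_zero[OF K] functionals_add[OF K] functionals_uminus[OF K] A)
  also have "Suc (k - 1) = k" using assms(2) by simp
  also have "card (transversals k ?\<Gamma> ?A) \<le> ex_num k n (suspension k (cycle (2 * l)))"
  proof (rule ex_num_suspension_cycle_ge[of "{..<k} \<times> ?\<Gamma>"])
    show "card ({..<k} \<times> ?\<Gamma>) \<le> n" using n by (simp add: \<Gamma>)
    show "\<not> suspended_cycle k (2 * l) (transversals k ?\<Gamma> ?A)"
      using transversals_no_suspended_cycle[OF alternating_free_eval0[OF l] l0(2) assms(2)] .
    show "e \<subseteq> {..<k} \<times> ?\<Gamma> \<and> card e = k" if "e \<in> transversals k ?\<Gamma> ?A" for e
      using that by (auto simp: transversals_def card_image inj_on_def)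
  qed (use \<Gamma> l0 in simp_all)
  finally show ?thesis .
qed

lemma ex_num_bigomega:
  assumes l: "l \<in> {3, 5}" and k: "k \<ge> 2"
  shows "(\<lambda>n. real (ex_num k n (suspension k (cycle (2 * l)))))
    \<in> \<Omega>(\<lambda>n. real n powr (real k - 1 + 1 / real l))"
proof -
  define r where "r = real k - 1 + 1 / real l"
  \<comment> \<open>The largest \<open>q = 2 ^ m\<close> with \<open>k * q ^ l \<le> n\<close>
    satisfies \<open>n \<le> k * (2 * q) ^ l\<close>; this constant absorbs the factor
    \<open>k * 2 ^ l\<close>.\<close>
  define C where "C = (real k * 2 ^ l) powr r"
  have l0: "l > 0" using l by auto
  have r: "r > 0" unfolding r_def using k l0 by (simp add: add_pos_nonneg)
  have C: "C > 0" unfolding C_def using k by simp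
  have "real n powr r \<le> C * real (ex_num k n (suspension k (cycle (2 * l))))"
    if n: "n \<ge> k * 2 ^ l" for n
  proof -
    define P where "P m \<longleftrightarrow> k * (2 ^ m) ^ l \<le> n" for m
    have bound: "m \<le> n" if "P m" for m
    proof -
      have "m < 2 ^ m" by (rule less_exp)
      also have "\<dots> \<le> (2 ^ m) ^ l" using l0 by (simp add: self_le_power)
      also have "\<dots> \<le> k * (2 ^ m) ^ l" using k by simp
      finally show ?thesis using that by (simp add: P_def)
    qed
    have P1: "P 1" using n by (simp add: P_def)
    define m where "m = Greatest P"
    have Pm: "P m" unfolding m_def using P1 bound by (rule GreatestI_nat)
    have m1: "m \<ge> 1" unfolding m_def using P1 bound by (rule Greatest_le_nat)
    have "\<not> P (Suc m)"
    proof
      assume "P (Suc m)"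
      then have "Suc m \<le> m" unfolding m_def using bound by (rule Greatest_le_nat)
      then show False by simp
    qed
    then have "n \<le> k * (2 ^ Suc m) ^ l" unfolding P_def by linarith
    also have "\<dots> = k * 2 ^ l * (2 ^ m) ^ l" unfolding power_Suc power_mult_distrib by simp
    finally have "real n \<le> real (k * 2 ^ l * (2 ^ m) ^ l)" by (simp only: of_nat_le_iff)
    then have "real n powr r \<le> (real k * 2 ^ l * (2 ^ m) ^ l) powr r"
      using r by (intro powr_mono2) simp_all
    also have "\<dots> = C * ((2 ^ m) ^ l) powr r" unfolding C_def by (rule powr_mult; simp)
    also have "((2 ^ m) ^ l) powr r = real ((2 ^ m) ^ (l * (k - 1) + 1))"
    proof -
      have "real (k - 1) = real k - 1" using k by simp
      then have "real l * r = real (l * (k - 1) + 1)"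
        using l0 by (simp add: r_def distrib_left)
      moreover have B: "(2 ^ m :: real) > 0" by simp
      have "((2 ^ m :: real) ^ l) powr r = (2 ^ m) powr (real l * r)"
        unfolding powr_realpow[OF B, symmetric] by (rule powr_powr)
      ultimately have "((2 ^ m :: real) ^ l) powr r = (2 ^ m) powr real (l * (k - 1) + 1)"
        by (simp only:)
      also have "\<dots> = (2 ^ m) ^ (l * (k - 1) + 1)" by (rule powr_realpow[OF B])
      finally show ?thesis by (simp only: of_nat_power of_nat_numeral)
    qed
    also have "C * real ((2 ^ m) ^ (l * (k - 1) + 1)) \<le> C * real (ex_num k n (suspension k (cycle (2 * l))))"
      using C ex_num_lower_bound[OF l k m1 refl] Pm unfolding P_def
      by (intro mult_left_mono) (simp_all only: of_nat_le_iff less_imp_le)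
    finally show ?thesis .
  qed
  then have "(\<lambda>n. real n powr r) \<in> O(\<lambda>n. real (ex_num k n (suspension k (cycle (2 * l)))))"
    by (intro bigoI[of _ C] eventually_sequentiallyI[of "k * 2 ^ l"]) simp
  then show ?thesis unfolding r_def[symmetric] by (simp add: bigomega_iff_bigo)
qed

section \<open>The upper bound\<close>

text \<open>Every edge splits into a set \<open>S\<close> of size \<open>k - 2\<close> and a pair in
  the link of \<open>S\<close>. A cycle of length \<open>2 * l\<close> in a link would give a
  suspended one, so \<open>even_cycle_bound\<close> applies to each of the at most
  \<open>card (verts G) ^ (k - 2)\<close> links.\<close>

lemma card_edges_le_of_no_suspended_cycle:
  assumes G: "uniform_hypergraph k G" and free: "\<not> suspended_cycle k (2 * l) (edges G)"
    and k: "k \<ge> 2" and l: "l \<ge> 3" and D: "card (verts G) < D ^ l"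
  shows "card (edges G) \<le> card (verts G) ^ (k - 2) * (2 * (l * (D + 3)) * card (verts G))"
proof -
  define V where "V = verts G"
  have V: "finite V" and E: "\<And>e. e \<in> edges G \<Longrightarrow> e \<subseteq> V \<and> card e = k"
    using G by (auto simp: uniform_hypergraph_def hypergraph_def V_def)
  define \<S> where "\<S> = {S. S \<subseteq> V \<and> card S = k - 2}"
  \<comment> \<open>Pairs must avoid \<open>S\<close>, so that a cycle in the link is disjoint from
    the core.\<close>
  define link where "link S = {e. card e = 2 \<and> e \<subseteq> V \<and> S \<inter> e = {} \<and> S \<union> e \<in> edges G}" for S
  have link_le: "card (link S) \<le> 2 * (l * (D + 3)) * card V" if S: "S \<in> \<S>" for S
  proof (rule even_cycle_bound[OF V _ _ l])
    show "card V < D ^ l" using D by (simp add: V_def)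
    show "card e = 2 \<and> e \<subseteq> V" if "e \<in> link S" for e using that by (simp add: link_def)
    show "\<not> (\<exists>ws. length ws = 2 * l \<and> distinct ws \<and> successively (\<lambda>u v. {u, v} \<in> link S) ws \<and>
        {last ws, hd ws} \<in> link S)"
    proof
      assume "\<exists>ws. length ws = 2 * l \<and> distinct ws \<and> successively (\<lambda>u v. {u, v} \<in> link S) ws \<and>
        {last ws, hd ws} \<in> link S"
      then obtain ws where ws: "length ws = 2 * l" "distinct ws" "successively (\<lambda>u v. {u, v} \<in> link S) ws"
        "{last ws, hd ws} \<in> link S" by blast
      have ne: "ws \<noteq> []" using ws(1) l by auto
      have edge: "{ws ! i, ws ! (Suc i mod (2 * l))} \<in> link S" if i: "i < 2 * l" for i
      proof (cases "Suc i = 2 * l")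
        case True
        then have "ws ! i = last ws" "ws ! (Suc i mod (2 * l)) = hd ws"
          using ws(1) ne by (auto simp: last_conv_nth hd_conv_nth dest: sym)
        then show ?thesis using ws(4) by simp
      next
        case False
        then show ?thesis using successively_nth[OF ws(3), of i] ws(1) i by simp
      qed
      have "inj_on ((!) ws) {..<2 * l}" using ws(1,2) by (simp add: inj_on_nth)
      moreover have "ws ! i \<notin> S" if "i < 2 * l" for i
        using edge[OF that] by (auto simp: link_def)
      then have "S \<inter> (!) ws ` {..<2 * l} = {}" by auto
      moreover have "finite S" "card S = k - 2" using S V finite_subset by (auto simp: \<S>_def)
      moreover have "S \<union> {ws ! i, ws ! (Suc i mod (2 * l))} \<in> edges G" if "i < 2 * l" for i
        using edge[OF that] by (simp add: link_def)
      ultimately have "suspended_cycle k (2 * l) (edges G)"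
        unfolding suspended_cycle_def by blast
      then show False using free by contradiction
    qed
  qed
  have fin_link: "finite (link S)" for S
    by (rule finite_subset[of _ "Pow V"]) (use V in \<open>auto simp: link_def\<close>)
  have fin_S: "finite \<S>" by (rule finite_subset[of _ "Pow V"]) (use V in \<open>auto simp: \<S>_def\<close>)
  have "edges G \<subseteq> (\<Union>S\<in>\<S>. (\<lambda>e. S \<union> e) ` link S)"
  proof
    fix e assume e: "e \<in> edges G"
    obtain S where S: "S \<subseteq> e" "card S = k - 2"
      using obtain_subset_with_card_n[of "k - 2" e] E[OF e] by (metis diff_le_self)
    have "finite e" using E[OF e] V finite_subset by blast
    then have "finite S" using S(1) finite_subset by blast
    then have "card (e - S) = k - (k - 2)" using S E[OF e] by (simp add: card_Diff_subset)
    then have "card (e - S) = 2" using k by simp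
    moreover have "S \<union> (e - S) = e" using S(1) by blast
    ultimately have "e - S \<in> link S" using e E[OF e] by (auto simp: link_def)
    moreover have "S \<in> \<S>" using S E[OF e] by (auto simp: \<S>_def)
    ultimately show "e \<in> (\<Union>S\<in>\<S>. (\<lambda>e. S \<union> e) ` link S)"
      using \<open>S \<union> (e - S) = e\<close> by blast
  qed
  then have "card (edges G) \<le> card (\<Union>S\<in>\<S>. (\<lambda>e. S \<union> e) ` link S)"
    by (rule card_mono[rotated]) (use fin_S fin_link in auto)
  also have "\<dots> \<le> (\<Sum>S\<in>\<S>. card ((\<lambda>e. S \<union> e) ` link S))"
    by (rule card_UN_le[OF fin_S])
  also have "\<dots> \<le> (\<Sum>S\<in>\<S>. 2 * (l * (D + 3)) * card V)"
    using order_trans[OF card_image_le[OF fin_link] link_le] by (intro sum_mono) blast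
  also have "\<dots> = card \<S> * (2 * (l * (D + 3)) * card V)" by simp
  also have "card \<S> \<le> card V ^ (k - 2)"
  proof (cases "k - 2 \<le> card V")
    case True
    then show ?thesis using n_subsets[OF V, of "k - 2"] binomial_le_pow by (simp add: \<S>_def)
  next
    case False
    then show ?thesis using n_subsets[OF V, of "k - 2"] by (simp add: \<S>_def binomial_eq_0)
  qed
  finally show ?thesis by (simp add: V_def)
qed

lemma ex_num_upper_bound:
  assumes k: "k \<ge> 2" and l: "l \<ge> 3" and D: "n < D ^ l"
  shows "ex_num k n (suspension k (cycle (2 * l))) \<le> n ^ (k - 2) * (2 * (l * (D + 3)) * n)"
proof -
  let ?H = "suspension k (cycle (2 * l))"
  let ?N = "{card (edges G) | G :: nat hypergraph. uniform_hypergraph k G \<and> card (verts G) = n \<and> is_free ?H G}"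
  have m: "2 * l > 0" using l by simp
  \<comment> \<open>The edgeless hypergraph makes the set nonempty, so that \<open>Max\<close> is
    attained.\<close>
  have "\<not> suspended_cycle k (2 * l) (edges ({..<n}, {}))"
    using m unfolding suspended_cycle_def snd_conv by blast
  moreover have "uniform_hypergraph k ({..<n}, {})"
    by (simp add: uniform_hypergraph_def hypergraph_def)
  ultimately have "card (edges ({..<n}, {} :: nat set set)) \<in> ?N"
    using is_free_suspension_cycle_iff[OF _ m, of "({..<n}, {})" k]
    by (intro CollectI exI[of _ "({..<n}, {})"]) (simp add: uniform_hypergraph_def)
  then have "?N \<noteq> {}" by blast
  from Max_in[OF finite_edge_numbers this] obtain G :: "nat hypergraph" where
    G: "ex_num k n ?H = card (edges G)" "uniform_hypergraph k G" "card (verts G) = n" "is_free ?H G"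
    unfolding ex_num_def by blast
  have "\<not> suspended_cycle k (2 * l) (edges G)"
    using G(2,4) is_free_suspension_cycle_iff[OF _ m, of G k] unfolding uniform_hypergraph_def by blast
  from card_edges_le_of_no_suspended_cycle[OF G(2) this k l, of D] D show ?thesis
    by (simp add: G)
qed

lemma ex_num_bigo:
  assumes k: "k \<ge> 2" and l: "l \<ge> 3"
  shows "(\<lambda>n. real (ex_num k n (suspension k (cycle (2 * l)))))
    \<in> O(\<lambda>n. real n powr (real k - 1 + 1 / real l))"
proof -
  have bound: "real (ex_num k n (suspension k (cycle (2 * l))))
      \<le> real (10 * l) * real n powr (real k - 1 + 1 / real l)" if n: "n \<ge> 1" for n
  proof -
    define y where "y = real n powr (1 / real l)"
    have y1: "y \<ge> 1" unfolding y_def using n by (intro ge_one_powr_ge_zero) simp_all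
    \<comment> \<open>The smallest integer above \<open>y\<close>, so that \<open>n < D ^ l\<close>;
      as \<open>y \<ge> 1\<close>, also \<open>D + 3 \<le> 5 * y\<close>, which with the factor
      \<open>2 * l\<close> gives the constant \<open>10 * l\<close>.\<close>
    define D where "D = nat \<lfloor>y\<rfloor> + 1"
    have D: "y < real D" "real D \<le> y + 1" unfolding D_def using y1 by linarith+
    have "real n = real n powr (1 / real l * real l)" using n l by simp
    also have "\<dots> = y powr real l" unfolding y_def by (rule powr_powr[symmetric])
    also have "\<dots> = y ^ l" using y1 by (intro powr_realpow) simp
    also have "\<dots> < real D ^ l" using y1 D(1) l by (intro power_strict_mono) simp_all
    finally have "real n < real (D ^ l)" by simp
    then have "n < D ^ l" by (simp only: of_nat_less_iff)
    from ex_num_upper_bound[OF k l this]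
    have "real (ex_num k n (suspension k (cycle (2 * l)))) \<le> real (n ^ (k - 2) * (2 * (l * (D + 3)) * n))"
      by (simp only: of_nat_le_iff)
    also have "\<dots> = real (2 * l) * real (D + 3) * real (n ^ (k - 2) * n)"
      by (simp only: of_nat_mult mult_ac)
    also have "\<dots> \<le> real (2 * l) * (5 * y) * real (n ^ (k - 2) * n)"
      using D(2) y1 by (intro mult_right_mono mult_left_mono) simp_all
    also have "real (n ^ (k - 2) * n) = real n powr real (k - 1)"
    proof -
      have "k - 1 = Suc (k - 2)" using k by simp
      then have "n ^ (k - 2) * n = n ^ (k - 1)" by simp
      moreover have "real n powr real (k - 1) = real n ^ (k - 1)"
        using n by (intro powr_realpow) simp
      ultimately show ?thesis by (simp only: of_nat_power)
    qed
    also have "real (2 * l) * (5 * y) * real n powr real (k - 1) = real (10 * l) * (real n powr real (k - 1) * y)"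
      by simp
    also have "real n powr real (k - 1) * y = real n powr (real (k - 1) + 1 / real l)"
      unfolding y_def by (rule powr_add[symmetric])
    also have "real (k - 1) = real k - 1" using k by simp
    finally show ?thesis .
  qed
  show ?thesis
    by (intro bigoI[of _ "real (10 * l)"] eventually_sequentiallyI[of 1]) (use bound in simp)
qed

theorem theorem4:
  fixes k l :: nat
  assumes "k \<ge> 2" and "l \<in> {3, 5}"
  shows "(\<lambda>n. real (ex_num k n (suspension k (cycle (2 * l)))))
           \<in> \<Theta>(\<lambda>n. real n powr (real k - 1 + 1 / real l))"
  using ex_num_bigo[of k l] ex_num_bigomega[of l k] assms by (auto intro: bigthetaI)

end
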